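(* There is an absolute constant $c>0$ such that for every $n\ge 3$ and every $3$-uniform hypergraph $H$ on $n$ vertices with at least one hyperedge, $Q(f_{[H]}) \ge c\, n^{3/2}$.
   Context: For $3$-uniform hypergraphs $H$ and $G$, a homomorphism from $H$ to $G$ is a map $h:V(H)\to V(G)$ such that for every hyperedge $\{u,v,w\}\in E(H)$, the set $\{h(u),h(v),h(w)\}$ is a hyperedge of $G$ (in particular has three distinct elements). For a fixed $3$-uniform hypergraph $H$ on $n$ vertices, $f_{[H]}:\{0,1\}^{\binom n3}\to\{0,1\}$ takes as input a $3$-uniform hypergraph $G$ on $[n]$ given by its $\binom n3$ hyperedge-indicator bits, and $f_{[H]}(G)=1$ iff $H$ admits a homomorphism into $G$. $Q(f)$ denotes the bounded-error (success probability at least $2/3$) quantum query complexity of a Boolean function $f$. *)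

theory Defs
  imports Complex_Main
begin

text \<open>
Input bits are indexed by a finite set I (of some type 'i). The Hilbert space of an
algorithm with workspace of dimension M has orthonormal basis
(None + Some ` I) \<times> {..<M}: a query register (None = null query, Some i = query bit i)
and a workspace register. States are functions basis \<Rightarrow> complex, operators are
matrices indexed by basis states. The phase_oracle O_x maps |Some i, w> to (-1)^(x i) |Some i, w>
and fixes |None, w>.
\<close>

definition qbasis :: "'i set \<Rightarrow> nat \<Rightarrow> ('i option \<times> nat) set" where
  "qbasis I M = (insert None (Some ` I)) \<times> {..<M}"

definition unitary_on :: "'b set \<Rightarrow> ('b \<Rightarrow> 'b \<Rightarrow> complex) \<Rightarrow> bool" where
  "unitary_on S U \<longleftrightarrow>
     (\<forall>a\<in>S. \<forall>b\<in>S. (\<Sum>c\<in>S. U a c * cnj (U b c)) = (if a = b then 1 else 0))"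

definition apply_op :: "'b set \<Rightarrow> ('b \<Rightarrow> 'b \<Rightarrow> complex) \<Rightarrow> ('b \<Rightarrow> complex) \<Rightarrow> ('b \<Rightarrow> complex)" where
  "apply_op S U v = (\<lambda>a. \<Sum>b\<in>S. U a b * v b)"

definition phase_oracle :: "('i \<Rightarrow> bool) \<Rightarrow> ('i option \<times> nat \<Rightarrow> complex) \<Rightarrow> ('i option \<times> nat \<Rightarrow> complex)" where
  "phase_oracle x v = (\<lambda>(q, w). (case q of None \<Rightarrow> 1 | Some i \<Rightarrow> (if x i then -1 else 1)) * v (q, w))"

primrec qstate :: "'i set \<Rightarrow> nat \<Rightarrow> (nat \<Rightarrow> ('i option \<times> nat) \<Rightarrow> ('i option \<times> nat) \<Rightarrow> complex)
                    \<Rightarrow> ('i \<Rightarrow> bool) \<Rightarrow> nat \<Rightarrow> ('i option \<times> nat \<Rightarrow> complex)" where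
  "qstate I M Us x 0 = apply_op (qbasis I M) (Us 0) (\<lambda>a. if a = (None, 0) then 1 else 0)"
| "qstate I M Us x (Suc k) = apply_op (qbasis I M) (Us (Suc k)) (phase_oracle x (qstate I M Us x k))"

definition accept_prob :: "'i set \<Rightarrow> nat \<Rightarrow> (nat \<Rightarrow> ('i option \<times> nat) \<Rightarrow> ('i option \<times> nat) \<Rightarrow> complex)
                    \<Rightarrow> ('i option \<times> nat \<Rightarrow> bool) \<Rightarrow> ('i \<Rightarrow> bool) \<Rightarrow> nat \<Rightarrow> real" where
  "accept_prob I M Us acc x T = (\<Sum>a\<in>qbasis I M. if acc a then (cmod (qstate I M Us x T a))^2 else 0)"

definition inputs :: "'i set \<Rightarrow> ('i \<Rightarrow> bool) set" where
  "inputs I = {x. \<forall>i. x i \<longrightarrow> i \<in> I}"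

definition computes_bounded :: "'i set \<Rightarrow> (('i \<Rightarrow> bool) \<Rightarrow> bool) \<Rightarrow> nat \<Rightarrow> bool" where
  "computes_bounded I f T \<longleftrightarrow>
     (\<exists>M Us acc. M \<ge> 1 \<and> (\<forall>k\<le>T. unitary_on (qbasis I M) (Us k)) \<and>
        (\<forall>x\<in>inputs I. (if f x then accept_prob I M Us acc x T
                               else 1 - accept_prob I M Us acc x T) \<ge> 2/3))"

definition Q :: "'i set \<Rightarrow> (('i \<Rightarrow> bool) \<Rightarrow> bool) \<Rightarrow> nat" where
  "Q I f = (LEAST T. computes_bounded I f T)"

definition triples :: "nat \<Rightarrow> nat set set" where
  "triples n = {e. e \<subseteq> {..<n} \<and> card e = 3}"

text \<open>f_[H] for H = ({..<n}, EH): input G is given by its hyperedge indicator bits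
x :: nat set \<Rightarrow> bool on triples n. Value 1 iff H has a homomorphism into G.\<close>
definition f_hom :: "nat \<Rightarrow> nat set set \<Rightarrow> (nat set \<Rightarrow> bool) \<Rightarrow> bool" where
  "f_hom n EH x \<longleftrightarrow>
     (\<exists>h :: nat \<Rightarrow> nat. (\<forall>v<n. h v < n) \<and>
        (\<forall>e\<in>EH. card (h ` e) = 3 \<and> h ` e \<in> triples n \<and> x (h ` e)))"

end

theory Submission
  imports Defs "HOL-Combinatorics.Permutations"
begin

text \<open>
The lower bound is the square root of the real degree of a restriction of \<open>f\<close>. If \<open>G\<close> is a
no-instance, \<open>G \<union> D\<close> a yes-instance with \<open>D\<close> disjoint from \<open>G\<close> and \<open>card D = 2 ^ m\<close>, and the
symmetries of \<open>f\<close> that preserve \<open>G\<close> act transitively on \<open>D\<close>, then an odd number of the graphs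
\<open>G \<union> Y\<close> with \<open>Y \<subseteq> D\<close> are yes-instances (Rivest and Vuillemin), so \<open>f\<close> has full degree on this
subcube; Huang's theorem provides a nonnegative vector on which the sensitivity graph has quadratic
form at least \<open>sqrt (2 ^ m)\<close>, and this vector serves as weight in the adversary method.

Suppose that fewer than \<open>c * n powr (3/2)\<close> queries suffice. Then removing from a yes-instance all
triples between three disjoint sets of size of order \<open>n\<close>, each a power of two, leaves a
yes-instance whenever the rest is symmetric enough. Starting from the complete hypergraph we can
thus remove all triples that meet both of two sets \<open>A\<close> and \<open>B\<close> of size \<open>q\<close> of order \<open>n\<close>.
Identifying \<open>A\<close> with \<open>B\<close> gives a map on \<open>n - q\<close> values which is injective on every edge of
\<open>H\<close>. The image of \<open>H\<close> therefore leaves room to blow up the three vertices of one edge of a minimal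
image, and the triples between the blown-up vertices contradict the same principle.
\<close>

section \<open>Unitary operators and inner products\<close>

text \<open>Gaussian elimination: an equation with a nonzero coefficient at \<open>b0\<close>
  eliminates that unknown from the others, and back-substitution recovers its value. It supplies
  both the surjectivity of adjoints and Huang's eigenvector.\<close>

lemma homogeneous_system_nontrivial:
  fixes M :: "'a \<Rightarrow> 'b \<Rightarrow> 'f::field"
  assumes "finite A" "finite B" "card A < card B"
  shows "\<exists>w. (\<exists>b\<in>B. w b \<noteq> 0) \<and> (\<forall>a\<in>A. (\<Sum>b\<in>B. M a b * w b) = 0)"
  using assms
proof (induction A arbitrary: B M rule: finite_induct)
  case empty
  then have "B \<noteq> {}" by auto
  then show ?case by (intro exI[of _ "\<lambda>_. 1"]) auto
next
  case (insert a0 A)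
  show ?case
  proof (cases "\<forall>b\<in>B. M a0 b = 0")
    case True
    from insert.IH[of B M] insert.prems insert.hyps obtain w where
      "\<exists>b\<in>B. w b \<noteq> 0" "\<forall>a\<in>A. (\<Sum>b\<in>B. M a b * w b) = 0" by auto
    with True show ?thesis by (intro exI[of _ w]) auto
  next
    case False
    then obtain b0 where b0: "b0 \<in> B" "M a0 b0 \<noteq> 0" by auto
    define M' where "M' a b = M a b - M a b0 * M a0 b / M a0 b0" for a b
    have "card A < card (B - {b0})" using insert b0 by auto
    then obtain w where w: "\<exists>b\<in>B - {b0}. w b \<noteq> 0"
      "\<forall>a\<in>A. (\<Sum>b\<in>B - {b0}. M' a b * w b) = 0"
      using insert.IH[of "B - {b0}" M'] insert.prems by auto
    define s where "s = - (\<Sum>b\<in>B - {b0}. M a0 b * w b) / M a0 b0"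
    define w' where "w' = w(b0 := s)"
    have split: "(\<Sum>b\<in>B. M a b * w' b) = M a b0 * s + (\<Sum>b\<in>B - {b0}. M a b * w b)" for a
      using b0 insert.prems by (simp add: sum.remove[of B b0] w'_def)
    have "(\<Sum>b\<in>B. M a b * w' b) = 0" if a: "a \<in> A" for a
    proof -
      have "0 = (\<Sum>b\<in>B - {b0}. M a b * w b - M a b0 / M a0 b0 * (M a0 b * w b))"
        using w(2) a by (auto simp: M'_def algebra_simps)
      also have "\<dots> = (\<Sum>b\<in>B - {b0}. M a b * w b) - M a b0 / M a0 b0 * (\<Sum>b\<in>B - {b0}. M a0 b * w b)"
        by (simp add: sum_subtractf sum_distrib_left)
      also have "\<dots> = (\<Sum>b\<in>B. M a b * w' b)" unfolding split s_def by (simp add: divide_simps)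
      finally show ?thesis by simp
    qed
    moreover have "(\<Sum>b\<in>B. M a0 b * w' b) = 0" unfolding split s_def using b0 by simp
    moreover have "\<exists>b\<in>B. w' b \<noteq> 0" using w(1) by (auto simp: w'_def)
    ultimately show ?thesis by (intro exI[of _ w']) auto
  qed
qed

definition inner_on :: "'b set \<Rightarrow> ('b \<Rightarrow> complex) \<Rightarrow> ('b \<Rightarrow> complex) \<Rightarrow> complex" where
  "inner_on S v w = (\<Sum>a\<in>S. cnj (v a) * w a)"

lemma cnj_inner_on: "cnj (inner_on S v w) = inner_on S w v"
  by (simp add: inner_on_def mult.commute)

lemma inner_on_self: "inner_on S v v = of_real (\<Sum>a\<in>S. (cmod (v a))\<^sup>2)"
  unfolding inner_on_def of_real_sum
  by (rule sum.cong) (simp_all add: complex_norm_square[symmetric] mult.commute)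

text \<open>\<open>unitary_on\<close> only states that the rows are orthonormal, while preserving
  inner products needs the other one-sided inverse. Dimension counting supplies it: \<open>v\<close>
  and the conjugated rows are \<open>card S + 1\<close> vectors of length \<open>card S\<close>,
  hence dependent.\<close>

lemma unitary_on_surj:
  assumes "finite S" and U: "unitary_on S U"
  shows "\<exists>w. \<forall>b\<in>S. v b = (\<Sum>a\<in>S. cnj (U a b) * w a)"
proof -
  define M where "M b c = (case c of None \<Rightarrow> v b | Some a \<Rightarrow> cnj (U a b))" for b c
  have card: "card S < card (insert None (Some ` S))"
    using assms(1) by (simp add: card_image)
  from homogeneous_system_nontrivial[OF assms(1) _ card, of M] assms(1)
  obtain w where w: "\<exists>c\<in>insert None (Some ` S). w c \<noteq> 0"
    "\<forall>b\<in>S. (\<Sum>c\<in>insert None (Some ` S). M b c * w c) = 0" by auto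
  have eq: "v b * w None + (\<Sum>a\<in>S. cnj (U a b) * w (Some a)) = 0" if "b \<in> S" for b
    using w(2) that assms(1) by (simp add: M_def sum.reindex)
  \<comment> \<open>Applying \<open>U\<close> to a relation without \<open>v\<close> isolates each
    coefficient by orthonormality, so the whole relation would be trivial.\<close>
  have "w None \<noteq> 0"
  proof
    assume none: "w None = 0"
    have "w (Some a) = 0" if a: "a \<in> S" for a
    proof -
      have "0 = (\<Sum>b\<in>S. U a b * (\<Sum>a'\<in>S. cnj (U a' b) * w (Some a')))"
        using eq none by simp
      also have "\<dots> = (\<Sum>b\<in>S. \<Sum>a'\<in>S. U a b * cnj (U a' b) * w (Some a'))"
        by (simp add: sum_distrib_left mult.assoc)
      also have "\<dots> = (\<Sum>a'\<in>S. (\<Sum>b\<in>S. U a b * cnj (U a' b)) * w (Some a'))"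
        by (subst sum.swap) (simp add: sum_distrib_right)
      also have "\<dots> = (\<Sum>a'\<in>S. (if a = a' then 1 else 0) * w (Some a'))"
        using U a unfolding unitary_on_def by (intro sum.cong) auto
      also have "\<dots> = (\<Sum>a'\<in>S. if a = a' then w (Some a') else 0)"
        by (intro sum.cong) auto
      also have "\<dots> = w (Some a)" using assms(1) a by simp
      finally show ?thesis by simp
    qed
    with w(1) none show False by auto
  qed
  then have "v b = (\<Sum>a\<in>S. cnj (U a b) * (- w (Some a) / w None))" if "b \<in> S" for b
    using eq[OF that] by (simp add: sum_negf sum_divide_distrib[symmetric] field_simps add_eq_0_iff)
  then show ?thesis by (intro exI[of _ "\<lambda>a. - w (Some a) / w None"]) auto
qed

text \<open>With \<open>v\<close> written as the adjoint of \<open>U\<close> applied to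
  \<open>w\<close>, the image of \<open>v\<close> is \<open>w\<close>, and the remaining
  \<open>U\<close> moves across the inner product.\<close>

lemma inner_on_apply_op:
  assumes "finite S" and U: "unitary_on S U"
  shows "inner_on S (apply_op S U v) (apply_op S U v') = inner_on S v v'"
proof -
  obtain w where w: "\<forall>b\<in>S. v b = (\<Sum>a\<in>S. cnj (U a b) * w a)"
    using unitary_on_surj[OF assms] by blast
  have Uv: "apply_op S U v a = w a" if a: "a \<in> S" for a
  proof -
    have "apply_op S U v a = (\<Sum>b\<in>S. U a b * (\<Sum>a'\<in>S. cnj (U a' b) * w a'))"
      unfolding apply_op_def using w by simp
    also have "\<dots> = (\<Sum>b\<in>S. \<Sum>a'\<in>S. U a b * cnj (U a' b) * w a')"
      by (simp add: sum_distrib_left mult.assoc)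
    also have "\<dots> = (\<Sum>a'\<in>S. (\<Sum>b\<in>S. U a b * cnj (U a' b)) * w a')"
      by (subst sum.swap) (simp add: sum_distrib_right)
    also have "\<dots> = (\<Sum>a'\<in>S. if a = a' then w a' else 0)"
      using U a unfolding unitary_on_def by (intro sum.cong) auto
    also have "\<dots> = w a" using assms(1) a by simp
    finally show ?thesis .
  qed
  have "inner_on S (apply_op S U v) (apply_op S U v') = (\<Sum>a\<in>S. \<Sum>b\<in>S. cnj (w a) * U a b * v' b)"
    unfolding inner_on_def using Uv by (simp add: apply_op_def sum_distrib_left mult.assoc)
  also have "\<dots> = (\<Sum>b\<in>S. (\<Sum>a\<in>S. U a b * cnj (w a)) * v' b)"
    by (subst sum.swap) (simp add: sum_distrib_left sum_distrib_right ac_simps)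
  also have "\<dots> = inner_on S v v'"
    unfolding inner_on_def using w by (intro sum.cong) simp_all
  finally show ?thesis .
qed

section \<open>States of a query algorithm\<close>

lemma finite_qbasis [simp]: "finite I \<Longrightarrow> finite (qbasis I M)"
  by (simp add: qbasis_def)

lemma inner_on_phase_oracle_same: "inner_on S (phase_oracle x v) (phase_oracle x w) = inner_on S v w"
  unfolding inner_on_def by (rule sum.cong) (auto simp: phase_oracle_def split: option.splits)

text \<open>The two oracles differ in sign exactly on the basis states that query
  \<open>i\<close>.\<close>

lemma inner_on_phase_oracle_flip:
  assumes "finite S" and "x i \<noteq> y i" and "\<And>j. j \<noteq> i \<Longrightarrow> x j = y j"
  shows "inner_on S (phase_oracle x v) (phase_oracle y w)
    = inner_on S v w - 2 * (\<Sum>a\<in>{a \<in> S. fst a = Some i}. cnj (v a) * w a)"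
proof -
  have "inner_on S (phase_oracle x v) (phase_oracle y w)
      = (\<Sum>a\<in>S. cnj (v a) * w a - (if fst a = Some i then 2 * (cnj (v a) * w a) else 0))"
    unfolding inner_on_def
  proof (rule sum.cong, simp)
    fix a assume "a \<in> S"
    show "cnj (phase_oracle x v a) * phase_oracle y w a
      = cnj (v a) * w a - (if fst a = Some i then 2 * (cnj (v a) * w a) else 0)"
      using assms(2,3) by (cases a; cases "fst a"; cases "fst a = Some i")
        (auto simp: phase_oracle_def)
  qed
  also have "\<dots> = inner_on S v w - (\<Sum>a\<in>S. if fst a = Some i then 2 * (cnj (v a) * w a) else 0)"
    by (simp add: inner_on_def sum_subtractf)
  also have "(\<Sum>a\<in>S. if fst a = Some i then 2 * (cnj (v a) * w a) else 0)
     = 2 * (\<Sum>a\<in>{a \<in> S. fst a = Some i}. cnj (v a) * w a)"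
    using assms(1) by (simp add: sum.inter_filter[symmetric] sum_distrib_left)
  finally show ?thesis .
qed

lemma inner_on_qstate_same:
  assumes "finite I" "M \<ge> 1" "\<And>k. k \<le> T \<Longrightarrow> unitary_on (qbasis I M) (Us k)" "k \<le> T"
  shows "inner_on (qbasis I M) (qstate I M Us x k) (qstate I M Us x k) = 1"
  using assms(4)
proof (induction k)
  case 0
  have "(None, 0) \<in> qbasis I M" using assms(2) by (auto simp: qbasis_def)
  then show ?case using assms(1,3)
    by (simp add: inner_on_apply_op) (simp add: inner_on_def if_distrib cong: if_cong)
next
  case (Suc k)
  then show ?case using assms(1,3) by (simp add: inner_on_apply_op inner_on_phase_oracle_same)
qed

text \<open>Cauchy-Schwarz on the accepting and rejecting parts would give
  \<open>2 * sqrt 2 / 3\<close>; AM-GM with rational weights gives the slightly larger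
  \<open>17/18\<close>. Any bound below 1 serves the adversary argument, up to its constant.\<close>

lemma inner_on_le_if_distinguished:
  assumes "finite S" "inner_on S v v = 1" "inner_on S w w = 1"
    and p: "(\<Sum>a\<in>S. if acc a then (cmod (v a))\<^sup>2 else 0) \<ge> 2/3"
    and r: "(\<Sum>a\<in>S. if acc a then (cmod (w a))\<^sup>2 else 0) \<le> 1/3"
  shows "cmod (inner_on S v w) \<le> 17/18"
proof -
  have v1: "(\<Sum>a\<in>S. (cmod (v a))\<^sup>2) = 1" and w1: "(\<Sum>a\<in>S. (cmod (w a))\<^sup>2) = 1"
    using assms(2,3) unfolding inner_on_self by (metis of_real_eq_1_iff)+
  define P R where "P = (\<Sum>a\<in>S. if acc a then (cmod (v a))\<^sup>2 else 0)"
    and "R = (\<Sum>a\<in>S. if acc a then (cmod (w a))\<^sup>2 else 0)"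
  \<comment> \<open>weighted AM-GM, with weight \<open>3/4\<close> on the accepting and \<open>4/3\<close> on the rejecting part\<close>
  have pt: "cmod (cnj (v a) * w a) \<le>
      2/3 * (cmod (v a))\<^sup>2 - 7/24 * (if acc a then (cmod (v a))\<^sup>2 else 0)
      + (3/8 * (cmod (w a))\<^sup>2 + 7/24 * (if acc a then (cmod (w a))\<^sup>2 else 0))" for a
  proof -
    have "0 \<le> (3 * cmod (v a) - 4 * cmod (w a))\<^sup>2" "0 \<le> (4 * cmod (v a) - 3 * cmod (w a))\<^sup>2"
      by simp_all
    then show ?thesis by (auto simp: norm_mult power2_eq_square algebra_simps)
  qed
  have "cmod (inner_on S v w) \<le> (\<Sum>a\<in>S. cmod (cnj (v a) * w a))"
    unfolding inner_on_def by (rule norm_sum)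
  also have "\<dots> \<le> (\<Sum>a\<in>S. 2/3 * (cmod (v a))\<^sup>2 - 7/24 * (if acc a then (cmod (v a))\<^sup>2 else 0)
      + (3/8 * (cmod (w a))\<^sup>2 + 7/24 * (if acc a then (cmod (w a))\<^sup>2 else 0)))"
    by (intro sum_mono pt)
  also have "\<dots> = 2/3 * (\<Sum>a\<in>S. (cmod (v a))\<^sup>2) - 7/24 * P + (3/8 * (\<Sum>a\<in>S. (cmod (w a))\<^sup>2) + 7/24 * R)"
    unfolding P_def R_def by (simp only: sum.distrib sum_subtractf sum_distrib_left)
  also have "\<dots> \<le> 17/18" using v1 w1 p r unfolding P_def[symmetric] R_def[symmetric] by simp
  finally show ?thesis .
qed

section \<open>The adversary method\<close>

definition flip :: "'i set \<Rightarrow> 'i \<Rightarrow> 'i set" where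
  "flip Y i = (if i \<in> Y then Y - {i} else insert i Y)"

lemma flip_flip [simp]: "flip (flip Y i) i = Y"
  by (auto simp: flip_def)

lemma even_card_flip: "finite Y \<Longrightarrow> even (card (flip Y i)) \<longleftrightarrow> odd (card Y)"
proof (cases "i \<in> Y")
  case True
  assume "finite Y"
  with True have "card Y = Suc (card (Y - {i}))" by (metis card_Suc_Diff1)
  with True show ?thesis by (simp add: flip_def)
qed (simp add: flip_def)

lemma mem_flip: "j \<in> flip Y i \<longleftrightarrow> (if j = i then i \<notin> Y else j \<in> Y)"
  by (auto simp: flip_def)

lemma flip_commute: "flip (flip Y i) j = flip (flip Y j) i"
  by (auto simp: mem_flip)

lemma flip_subset: "Y \<subseteq> D \<Longrightarrow> i \<in> D \<Longrightarrow> flip Y i \<subseteq> D"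
  by (auto simp: flip_def)

text \<open>Positive-weight adversary argument. The progress measure is the weighted sum of the inner
  products of states on neighbouring inputs; one query changes it by at most \<open>2 * (\<Sum>Y. (u Y)\<^sup>2)\<close>.\<close>

lemma adversary_bound:
  fixes u :: "'i set \<Rightarrow> real"
  assumes I: "finite I" and D: "D \<subseteq> I" and G: "G \<subseteq> I" "G \<inter> D = {}" and S: "S \<subseteq> Pow D"
    and u: "\<And>Y. u Y \<ge> 0"
    and sens: "\<And>Y i. Y \<in> S \<Longrightarrow> i \<in> D \<Longrightarrow> flip Y i \<in> S \<Longrightarrow>
      f (\<lambda>j. j \<in> G \<union> Y) \<noteq> f (\<lambda>j. j \<in> G \<union> flip Y i)"
    and comp: "computes_bounded I f T"
  shows "(\<Sum>Y\<in>S. \<Sum>i\<in>{i \<in> D. flip Y i \<in> S}. u Y * u (flip Y i)) \<le> 36 * real T * (\<Sum>Y\<in>S. (u Y)\<^sup>2)"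
proof -
  from comp obtain M Us acc where M: "M \<ge> 1" and U: "\<And>k. k \<le> T \<Longrightarrow> unitary_on (qbasis I M) (Us k)"
    and acc: "\<And>x. x \<in> inputs I \<Longrightarrow> (if f x then accept_prob I M Us acc x T
                               else 1 - accept_prob I M Us acc x T) \<ge> 2/3"
    unfolding computes_bounded_def by blast
  define B where "B = qbasis I M"
  have finB: "finite B" using I by (simp add: B_def)
  define X where "X Y = (\<lambda>j. j \<in> G \<union> Y)" for Y
  define psi where "psi Y k = qstate I M Us (X Y) k" for Y k
  \<comment> \<open>Directed edges of the cube inside \<open>S\<close>, each edge appearing once
    from either end.\<close>
  define E where "E = (SIGMA Y:S. {i \<in> D. flip Y i \<in> S})"
  have finD: "finite D" using D I by (rule finite_subset)
  have finS: "finite S" using S finD by (meson finite_Pow_iff finite_subset)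
  have finE: "finite E" unfolding E_def using finS finD by auto
  define L where "L = (\<Sum>(Y, i)\<in>E. u Y * u (flip Y i))"
  define N where "N = (\<Sum>Y\<in>S. (u Y)\<^sup>2)"
  define W where "W k = (\<Sum>(Y, i)\<in>E. of_real (u Y * u (flip Y i)) * inner_on B (psi Y k) (psi (flip Y i) k))" for k
  have norm1: "inner_on B (psi Y k) (psi Y k) = 1" if "k \<le> T" for Y k
    unfolding B_def psi_def using inner_on_qstate_same[OF I M U that] by simp
  have norm1': "(\<Sum>a\<in>B. (cmod (psi Y k a))\<^sup>2) = 1" if "k \<le> T" for Y k
    using norm1[OF that, of Y] unfolding inner_on_self by (metis of_real_eq_1_iff)
  have L_alt: "(\<Sum>Y\<in>S. \<Sum>i\<in>{i \<in> D. flip Y i \<in> S}. u Y * u (flip Y i)) = L"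
    unfolding L_def E_def using finS finD by (subst sum.Sigma) auto
  have L0: "L \<ge> 0" unfolding L_def using u by (intro sum_nonneg) auto
  have "psi Y 0 = psi {} 0" for Y by (simp add: psi_def)
  then have "inner_on B (psi Y 0) (psi Z 0) = 1" for Y Z
    using norm1[OF le0] by metis
  \<comment> \<open>All runs start in the same state, so every inner product is 1 before the first
    query.\<close>
  then have W0: "W 0 = of_real L"
    unfolding W_def L_def of_real_sum by (intro sum.cong) auto
  have step: "cmod (W (Suc k) - W k) \<le> 2 * N" if k: "Suc k \<le> T" for k
  proof -
    \<comment> \<open>The squared weight that the run on \<open>Y\<close> puts on querying bit
      \<open>i\<close> next; over all \<open>i\<close> it sums to at most 1.\<close>
    define Q where "Q Y i = (\<Sum>a\<in>{a \<in> B. fst a = Some i}. (cmod (psi Y k a))\<^sup>2)" for Y i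
    have summand: "cmod (of_real (u Y * u (flip Y i)) * inner_on B (psi Y (Suc k)) (psi (flip Y i) (Suc k))
         - of_real (u Y * u (flip Y i)) * inner_on B (psi Y k) (psi (flip Y i) k))
        \<le> (u Y)\<^sup>2 * Q Y i + (u (flip Y i))\<^sup>2 * Q (flip Y i) i" if E: "(Y, i) \<in> E" for Y i
    proof -
      let ?Z = "flip Y i" and ?B = "{a \<in> B. fst a = Some i}"
      have i: "i \<in> D" and Y: "Y \<subseteq> D" using E S unfolding E_def by auto
      then have "i \<notin> G" using G by auto
      have "inner_on B (psi Y (Suc k)) (psi ?Z (Suc k))
          = inner_on B (phase_oracle (X Y) (psi Y k)) (phase_oracle (X ?Z) (psi ?Z k))"
        unfolding psi_def B_def using k U[OF k] I by (simp add: inner_on_apply_op)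
      also have "\<dots> = inner_on B (psi Y k) (psi ?Z k) - 2 * (\<Sum>a\<in>?B. cnj (psi Y k a) * psi ?Z k a)"
        using \<open>i \<notin> G\<close> by (intro inner_on_phase_oracle_flip[OF finB]) (auto simp: X_def mem_flip)
      finally have "cmod (of_real (u Y * u ?Z) * inner_on B (psi Y (Suc k)) (psi ?Z (Suc k))
         - of_real (u Y * u ?Z) * inner_on B (psi Y k) (psi ?Z k))
         = cmod (of_real (u Y * u ?Z) * (2 * (\<Sum>a\<in>?B. cnj (psi Y k a) * psi ?Z k a)))"
        by (simp add: norm_minus_commute[symmetric] right_diff_distrib norm_mult)
      also have "\<dots> = 2 * (u Y * u ?Z) * cmod (\<Sum>a\<in>?B. cnj (psi Y k a) * psi ?Z k a)"
        using u by (simp add: norm_mult abs_mult)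
      also have "\<dots> \<le> 2 * (u Y * u ?Z) * (\<Sum>a\<in>?B. cmod (cnj (psi Y k a) * psi ?Z k a))"
        using u by (intro mult_left_mono norm_sum) simp
      also have "\<dots> = (\<Sum>a\<in>?B. 2 * ((u Y * cmod (psi Y k a)) * (u ?Z * cmod (psi ?Z k a))))"
        by (simp add: sum_distrib_left norm_mult mult_ac)
      also have "\<dots> \<le> (\<Sum>a\<in>?B. (u Y * cmod (psi Y k a))\<^sup>2 + (u ?Z * cmod (psi ?Z k a))\<^sup>2)"
      proof (rule sum_mono)
        fix a
        show "2 * ((u Y * cmod (psi Y k a)) * (u ?Z * cmod (psi ?Z k a)))
          \<le> (u Y * cmod (psi Y k a))\<^sup>2 + (u ?Z * cmod (psi ?Z k a))\<^sup>2"
          using sum_squares_bound[of "u Y * cmod (psi Y k a)" "u ?Z * cmod (psi ?Z k a)"]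
          by (simp only: mult.assoc)
      qed
      also have "\<dots> = (u Y)\<^sup>2 * Q Y i + (u ?Z)\<^sup>2 * Q ?Z i"
        by (simp add: sum.distrib Q_def power_mult_distrib sum_distrib_left)
      finally show ?thesis .
    qed
    \<comment> \<open>Reversing directed edges is an involution of \<open>E\<close>, so both
      endpoints contribute equally.\<close>
    have swap: "(\<Sum>(Y, i)\<in>E. (u (flip Y i))\<^sup>2 * Q (flip Y i) i) = (\<Sum>(Y, i)\<in>E. (u Y)\<^sup>2 * Q Y i)"
      by (rule sum.reindex_bij_witness[where i = "\<lambda>(Y, i). (flip Y i, i)" and j = "\<lambda>(Y, i). (flip Y i, i)"])
         (auto simp: E_def)
    have "(\<Sum>(Y, i)\<in>E. (u Y)\<^sup>2 * Q Y i) = (\<Sum>Y\<in>S. (u Y)\<^sup>2 * (\<Sum>i\<in>{i \<in> D. flip Y i \<in> S}. Q Y i))"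
      unfolding E_def using finS finD by (subst sum.Sigma[symmetric]) (auto simp: sum_distrib_left)
    also have "\<dots> \<le> (\<Sum>Y\<in>S. (u Y)\<^sup>2 * 1)"
    proof (intro sum_mono mult_left_mono)
      fix Y
      have "(\<Sum>i\<in>{i \<in> D. flip Y i \<in> S}. Q Y i) \<le> (\<Sum>i\<in>D. Q Y i)"
        using finD by (intro sum_mono2) (auto simp: Q_def sum_nonneg)
      also have "\<dots> = (\<Sum>a\<in>(\<Union>i\<in>D. {a \<in> B. fst a = Some i}). (cmod (psi Y k a))\<^sup>2)"
        unfolding Q_def using finB finD by (intro sum.UNION_disjoint[symmetric]) auto
      also have "\<dots> \<le> (\<Sum>a\<in>B. (cmod (psi Y k a))\<^sup>2)"
        using finB by (intro sum_mono2) auto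
      also have "\<dots> = 1" using norm1' k by simp
      finally show "(\<Sum>i\<in>{i \<in> D. flip Y i \<in> S}. Q Y i) \<le> 1" .
    qed simp
    finally have EN: "(\<Sum>(Y, i)\<in>E. (u Y)\<^sup>2 * Q Y i) \<le> N" by (simp add: N_def)
    have "cmod (W (Suc k) - W k) \<le> (\<Sum>(Y, i)\<in>E. (u Y)\<^sup>2 * Q Y i + (u (flip Y i))\<^sup>2 * Q (flip Y i) i)"
      unfolding W_def sum_subtractf[symmetric]
      by (rule order_trans[OF norm_sum], rule sum_mono) (use summand in auto)
    also have "\<dots> = (\<Sum>(Y, i)\<in>E. (u Y)\<^sup>2 * Q Y i) + (\<Sum>(Y, i)\<in>E. (u (flip Y i))\<^sup>2 * Q (flip Y i) i)"
      by (simp add: case_prod_unfold sum.distrib)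
    also have "\<dots> \<le> 2 * N" using swap EN by simp
    finally show ?thesis .
  qed
  have "k \<le> T \<Longrightarrow> cmod (W 0 - W k) \<le> 2 * N * real k" for k
  proof (induction k)
    case (Suc k)
    have "cmod (W 0 - W (Suc k)) \<le> cmod (W 0 - W k) + cmod (W (Suc k) - W k)"
      by (metis norm_minus_commute norm_triangle_ineq4 diff_diff_eq2 diff_add_cancel add_diff_eq)
    then show ?case using Suc step[of k] by (simp add: algebra_simps)
  qed simp
  then have tele: "cmod (W 0 - W T) \<le> 2 * N * real T" by simp
  \<comment> \<open>Neighbours inside \<open>S\<close> have different function values, so the final
    measurement must separate their states.\<close>
  have "cmod (inner_on B (psi Y T) (psi (flip Y i) T)) \<le> 17/18" if E: "(Y, i) \<in> E" for Y i
  proof -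
    let ?Z = "flip Y i"
    have i: "i \<in> D" and Y: "Y \<subseteq> D" "Y \<in> S" "?Z \<in> S" using E S unfolding E_def by auto
    have inp: "X Y \<in> inputs I" "X ?Z \<in> inputs I"
      using G(1) D Y flip_subset[OF Y(1) i] unfolding X_def inputs_def by auto
    have ap: "accept_prob I M Us acc (X Y') T = (\<Sum>a\<in>B. if acc a then (cmod (psi Y' T a))\<^sup>2 else 0)" for Y'
      unfolding accept_prob_def B_def psi_def ..
    have fne: "f (X Y) \<noteq> f (X ?Z)" using sens[OF Y(2) i Y(3)] by (simp add: X_def)
    show ?thesis
    proof (cases "f (X Y)")
      case True
      with fne acc[OF inp(1)] acc[OF inp(2)] show ?thesis
        by (intro inner_on_le_if_distinguished[OF finB norm1 norm1, where acc = acc]) (auto simp: ap)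
    next
      case False
      with fne acc[OF inp(1)] acc[OF inp(2)] have "cmod (inner_on B (psi ?Z T) (psi Y T)) \<le> 17/18"
        by (intro inner_on_le_if_distinguished[OF finB norm1 norm1, where acc = acc]) (auto simp: ap)
      then show ?thesis by (metis cnj_inner_on complex_mod_cnj)
    qed
  qed
  then have far: "cmod (of_real (u Y * u (flip Y i)) * inner_on B (psi Y T) (psi (flip Y i) T))
      \<le> u Y * u (flip Y i) * (17/18)" if "(Y, i) \<in> E" for Y i
    using that u unfolding norm_mult norm_of_real abs_mult by (intro mult_mono) auto
  have "cmod (W T) \<le> (\<Sum>(Y, i)\<in>E. u Y * u (flip Y i) * (17/18))"
    unfolding W_def by (intro order_trans[OF norm_sum] sum_mono) (use far in auto)
  also have "\<dots> = L * (17/18)" by (simp only: L_def sum_distrib_right case_prod_unfold)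
  finally have WT: "cmod (W T) \<le> L * (17/18)" .
  \<comment> \<open>The gap \<open>1 - 17/18\<close> and the change of at most \<open>2 * N\<close>
    per query combine to the constant 36.\<close>
  have "L = cmod (W 0)" using W0 L0 by simp
  also have "\<dots> \<le> cmod (W 0 - W T) + cmod (W T)" by (metis norm_triangle_sub add.commute)
  also have "\<dots> \<le> 2 * N * real T + L * (17/18)" using tele WT by simp
  finally show ?thesis unfolding L_alt N_def[symmetric] by (simp add: algebra_simps)
qed

section \<open>Sensitivity and degree\<close>

text \<open>Huang's signing of the hypercube: with the Jordan--Wigner signs the flips anticommute and
  square to the identity, so the signed adjacency operator squares to the dimension.\<close>

definition jw_sign :: "('i \<Rightarrow> nat) \<Rightarrow> 'i set \<Rightarrow> 'i \<Rightarrow> real" where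
  "jw_sign r Y i = (-1) ^ card {j \<in> Y. r j < r i}"

definition huang_op :: "('i \<Rightarrow> nat) \<Rightarrow> 'i set \<Rightarrow> ('i set \<Rightarrow> real) \<Rightarrow> 'i set \<Rightarrow> real" where
  "huang_op r D v Y = (\<Sum>i\<in>D. jw_sign r Y i * v (flip Y i))"

lemma jw_sign_abs [simp]: "\<bar>jw_sign r Y i\<bar> = 1"
  by (simp add: jw_sign_def power_abs)

lemma jw_sign_square [simp]: "jw_sign r Y i * jw_sign r Y i = 1"
  by (simp add: jw_sign_def power_add[symmetric] flip: mult_2)

lemma jw_sign_flip_le: "r j \<le> r i \<Longrightarrow> jw_sign r (flip Y i) j = jw_sign r Y j"
proof -
  assume "r j \<le> r i"
  then have "{k \<in> flip Y i. r k < r j} = {k \<in> Y. r k < r j}" by (auto simp: mem_flip split: if_splits)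
  then show ?thesis by (simp add: jw_sign_def)
qed

lemma jw_sign_flip_less:
  assumes "finite Y" "r i < r j"
  shows "jw_sign r (flip Y i) j = - jw_sign r Y j"
proof (cases "i \<in> Y")
  case True
  then have "{k \<in> Y. r k < r j} = insert i {k \<in> flip Y i. r k < r j}"
    using assms by (auto simp: mem_flip split: if_splits)
  moreover have "i \<notin> {k \<in> flip Y i. r k < r j}" "finite {k \<in> flip Y i. r k < r j}"
    using True assms by (auto simp: flip_def)
  ultimately show ?thesis by (simp add: jw_sign_def)
next
  case False
  then have "{k \<in> flip Y i. r k < r j} = insert i {k \<in> Y. r k < r j}"
    using assms by (auto simp: mem_flip split: if_splits)
  then show ?thesis using False assms by (simp add: jw_sign_def)
qed

lemma huang_op_square:
  assumes "finite D" "inj_on r D" "Y \<subseteq> D"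
  shows "huang_op r D (huang_op r D v) Y = real (card D) * v Y"
proof -
  define c where "c i j = jw_sign r Y i * jw_sign r (flip Y i) j * v (flip (flip Y i) j)" for i j
  have finY: "finite Y" using assms finite_subset by blast
  \<comment> \<open>A flip changes the sign attached to directions of larger rank only, so exactly
    one of the two orders of flipping picks up a minus sign.\<close>
  have anti: "c i j = - c j i" if ij: "i \<in> D" "j \<in> D" "i \<noteq> j" for i j
  proof -
    have "c i j = - c j i" if "r i < r j" for i j
      using that jw_sign_flip_less[OF finY that] jw_sign_flip_le[of r i j Y]
      by (simp add: c_def flip_commute[of Y i j])
    then show ?thesis using ij assms(2) by (metis inj_onD linorder_neqE_nat minus_minus)
  qed
  have diag: "c i i = v Y" for i
    by (simp add: c_def jw_sign_flip_le)
  have "huang_op r D (huang_op r D v) Y = (\<Sum>i\<in>D. \<Sum>j\<in>D. c i j)"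
    by (simp add: huang_op_def c_def sum_distrib_left mult.assoc)
  also have "\<dots> = (\<Sum>i\<in>D. \<Sum>j\<in>D. (if i = j then v Y else 0) + (if i = j then 0 else c i j))"
    using diag by (intro sum.cong) auto
  also have "\<dots> = real (card D) * v Y + (\<Sum>i\<in>D. \<Sum>j\<in>D. if i = j then 0 else c i j)"
    using assms(1) by (simp add: sum.distrib)
  also have "(\<Sum>i\<in>D. \<Sum>j\<in>D. if i = j then 0 else c i j) = 0" (is "?s = 0")
  proof -
    have "?s = (\<Sum>i\<in>D. \<Sum>j\<in>D. - (if j = i then 0 else c j i))"
    proof (rule sum.cong[OF refl], rule sum.cong[OF refl])
      fix i j assume "i \<in> D" "j \<in> D"
      then show "(if i = j then 0 else c i j) = - (if j = i then 0 else c j i)"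
        using anti[of i j] by auto
    qed
    also have "\<dots> = - (\<Sum>i\<in>D. \<Sum>j\<in>D. if j = i then 0 else c j i)" by (simp add: sum_negf)
    also have "(\<Sum>i\<in>D. \<Sum>j\<in>D. if j = i then 0 else c j i) = ?s" by (rule sum.swap)
    finally show ?thesis by simp
  qed
  finally show ?thesis by simp
qed

lemma huang_op_linear:
  "huang_op r D (\<lambda>Y. s * v Y + v' Y) Y = s * huang_op r D v Y + huang_op r D v' Y"
  by (simp add: huang_op_def sum.distrib distrib_left sum_distrib_left mult_ac)

lemma card_Pow_notin:
  assumes "finite D" "i0 \<in> D"
  shows "2 * card {Y. Y \<subseteq> D \<and> i0 \<notin> Y} = 2 ^ card D"
proof -
  have "{Y. Y \<subseteq> D \<and> i0 \<notin> Y} = Pow (D - {i0})" by auto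
  then have "card {Y. Y \<subseteq> D \<and> i0 \<notin> Y} = 2 ^ (card D - 1)"
    using assms by (simp add: card_Pow)
  moreover have "card D = Suc (card D - 1)" using assms by (metis card_Suc_Diff1 card_Diff_singleton)
  ultimately show ?thesis by (metis power_Suc)
qed

text \<open>Huang's theorem in vector form. The eigenvectors of the signed cube for
  \<open>sqrt (card D)\<close> contain a space of half the full dimension, and vanishing outside
  \<open>S\<close> imposes fewer conditions than that. The absolute values of a nonzero eigenvector
  obeying them serve as weights.\<close>

lemma huang_weights:
  assumes "finite D" "S \<subseteq> Pow D" "2 * card S > 2 ^ card D" "D \<noteq> {}"
  shows "\<exists>u. (\<forall>Y. u Y \<ge> (0::real)) \<and> (\<Sum>Y\<in>S. (u Y)\<^sup>2) > 0 \<and>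
    sqrt (card D) * (\<Sum>Y\<in>S. (u Y)\<^sup>2) \<le> (\<Sum>Y\<in>S. \<Sum>i\<in>{i \<in> D. flip Y i \<in> S}. u Y * u (flip Y i))"
proof -
  obtain r :: "'a \<Rightarrow> nat" where r: "inj_on r D" using assms(1) finite_imp_inj_to_nat_seg by metis
  obtain i0 where i0: "i0 \<in> D" using assms(4) by auto
  \<comment> \<open>Vectors \<open>w'\<close> supported on the facet avoiding \<open>i0\<close>
    parametrise the eigenvectors as \<open>s * w' + huang_op r D w'\<close>.\<close>
  define Z where "Z = {Y. Y \<subseteq> D \<and> i0 \<notin> Y}"
  define s where "s = sqrt (card D)"
  have finPow: "finite (Pow D)" using assms(1) by simp
  have finS: "finite S" using finite_subset[OF assms(2) finPow] .
  have finZ: "finite Z" unfolding Z_def using assms(1) by simp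
  have "card (Pow D - S) = 2 ^ card D - card S"
    using assms(1,2) finS by (simp add: card_Diff_subset card_Pow)
  moreover have "card S \<le> 2 ^ card D" using card_mono[OF finPow assms(2)] assms(1) by (simp add: card_Pow)
  ultimately have card: "card (Pow D - S) < card Z"
    using assms(3) card_Pow_notin[OF assms(1) i0] unfolding Z_def by linarith
  define M :: "'a set \<Rightarrow> 'a set \<Rightarrow> real" where
    "M Y Y' = (if Y' = Y then s else 0) + (\<Sum>i\<in>D. jw_sign r Y i * (if Y' = flip Y i then 1 else 0))" for Y Y'
  obtain w where w: "\<exists>Y\<in>Z. w Y \<noteq> 0" "\<forall>Y\<in>Pow D - S. (\<Sum>Y'\<in>Z. M Y Y' * w Y') = 0"
    using homogeneous_system_nontrivial[of "Pow D - S" Z M] card finPow finZ by auto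
  define w' where "w' Y = (if Y \<in> Z then w Y else 0)" for Y
  define v where "v Y = s * w' Y + huang_op r D w' Y" for Y
  have Mv: "(\<Sum>Y'\<in>Z. M Y Y' * w Y') = v Y" for Y
  proof -
    have "(\<Sum>Y'\<in>Z. M Y Y' * w Y') = (\<Sum>Y'\<in>Z. if Y' = Y then s * w Y' else 0)
        + (\<Sum>Y'\<in>Z. \<Sum>i\<in>D. if Y' = flip Y i then jw_sign r Y i * w Y' else 0)"
      unfolding M_def distrib_right sum.distrib sum_distrib_right
      by (intro arg_cong2[where f = "(+)"] sum.cong) auto
    also have "(\<Sum>Y'\<in>Z. \<Sum>i\<in>D. if Y' = flip Y i then jw_sign r Y i * w Y' else 0)
      = (\<Sum>i\<in>D. \<Sum>Y'\<in>Z. if Y' = flip Y i then jw_sign r Y i * w Y' else 0)" by (rule sum.swap)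
    also have "\<dots> = huang_op r D w' Y"
      unfolding huang_op_def using finZ by (intro sum.cong) (auto simp: w'_def)
    also have "(\<Sum>Y'\<in>Z. if Y' = Y then s * w Y' else 0) = s * w' Y"
      using finZ by (simp add: w'_def)
    finally show ?thesis by (simp add: v_def)
  qed
  have v_out: "v Y = 0" if "Y \<subseteq> D" "Y \<notin> S" for Y using w(2) that Mv by auto
  have ss: "s * s = card D" by (simp add: s_def)
  \<comment> \<open>With \<open>h\<close> for the operator, \<open>h * (s + h) = s * (s + h)\<close>
    because \<open>h * h = s * s\<close>.\<close>
  have eig: "huang_op r D v Y = s * v Y" if Y: "Y \<subseteq> D" for Y
  proof -
    have "v = (\<lambda>Y. s * w' Y + huang_op r D w' Y)" by (simp add: v_def fun_eq_iff)
    then have "huang_op r D v Y = s * huang_op r D w' Y + huang_op r D (huang_op r D w') Y"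
      by (simp only: huang_op_linear)
    also have "huang_op r D (huang_op r D w') Y = s * s * w' Y"
      using huang_op_square[OF assms(1) r Y] ss by simp
    finally show ?thesis by (simp add: v_def[of Y] algebra_simps)
  qed
  have "\<exists>Y\<in>S. v Y \<noteq> 0"
  proof -
    obtain Y where Y: "Y \<in> Z" "w Y \<noteq> 0" using w(1) by auto
    \<comment> \<open>outside \<open>Z\<close>, only the flip in direction \<open>i0\<close> leads back to the support of \<open>w'\<close>\<close>
    have "huang_op r D w' (flip Y i0) = (\<Sum>i\<in>D. if i = i0 then jw_sign r (flip Y i0) i0 * w Y else 0)"
      unfolding huang_op_def
    proof (rule sum.cong)
      fix i assume "i \<in> D"
      show "jw_sign r (flip Y i0) i * w' (flip (flip Y i0) i)
        = (if i = i0 then jw_sign r (flip Y i0) i0 * w Y else 0)"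
        using Y by (auto simp: w'_def Z_def mem_flip)
    qed simp
    also have "\<dots> = jw_sign r (flip Y i0) i0 * w Y" using assms(1) i0 by simp
    finally have "v (flip Y i0) = jw_sign r (flip Y i0) i0 * w Y"
      using Y by (simp add: v_def w'_def Z_def mem_flip)
    then have "v (flip Y i0) \<noteq> 0" using Y by (simp add: jw_sign_def)
    moreover have "flip Y i0 \<subseteq> D" using Y i0 by (intro flip_subset) (auto simp: Z_def)
    ultimately show ?thesis using v_out by blast
  qed
  then have pos: "(\<Sum>Y\<in>S. (\<bar>v Y\<bar>)\<^sup>2) > 0" using finS by (auto intro!: sum_pos2)
  have "s * (\<Sum>Y\<in>S. (\<bar>v Y\<bar>)\<^sup>2) = (\<Sum>Y\<in>S. v Y * huang_op r D v Y)"
    unfolding sum_distrib_left using eig assms(2) by (intro sum.cong) (auto simp: power2_eq_square)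
  also have "\<dots> = (\<Sum>Y\<in>S. \<Sum>i\<in>D. v Y * (jw_sign r Y i * v (flip Y i)))"
    by (simp add: huang_op_def sum_distrib_left)
  also have "\<dots> = (\<Sum>Y\<in>S. \<Sum>i\<in>{i \<in> D. flip Y i \<in> S}. v Y * (jw_sign r Y i * v (flip Y i)))"
  proof (rule sum.cong[OF refl], rule sum.mono_neutral_right)
    fix Y assume "Y \<in> S"
    then have "v (flip Y i) = 0" if "i \<in> D" "flip Y i \<notin> S" for i
      using assms(2) that by (intro v_out flip_subset) auto
    then show "\<forall>i\<in>D - {i \<in> D. flip Y i \<in> S}. v Y * (jw_sign r Y i * v (flip Y i)) = 0" by auto
  qed (use assms(1) in auto)
  \<comment> \<open>Passing to absolute values removes the signs and can only increase the
    form.\<close>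
  also have "\<dots> \<le> (\<Sum>Y\<in>S. \<Sum>i\<in>{i \<in> D. flip Y i \<in> S}. \<bar>v Y\<bar> * \<bar>v (flip Y i)\<bar>)"
  proof (intro sum_mono)
    fix Y i
    have "v Y * (jw_sign r Y i * v (flip Y i)) \<le> \<bar>v Y * (jw_sign r Y i * v (flip Y i))\<bar>" by simp
    also have "\<dots> = \<bar>v Y\<bar> * \<bar>v (flip Y i)\<bar>" by (simp add: abs_mult)
    finally show "v Y * (jw_sign r Y i * v (flip Y i)) \<le> \<bar>v Y\<bar> * \<bar>v (flip Y i)\<bar>" .
  qed
  finally show ?thesis using pos unfolding s_def by (intro exI[of _ "\<lambda>Y. \<bar>v Y\<bar>"]) auto
qed

text \<open>Rivest and Vuillemin: for \<open>0 < w < 2 ^ m\<close>, double counting the incidences between the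
  points of \<open>D\<close> and the \<open>w\<close>-subsets satisfying the predicate shows that \<open>2 ^ m\<close> divides \<open>w\<close>
  times the number of these subsets, so this number is even.\<close>

lemma odd_card_transitive:
  assumes "finite D" "card D = 2 ^ m"
    and trans: "\<And>i j. i \<in> D \<Longrightarrow> j \<in> D \<Longrightarrow>
      \<exists>g. inj_on g D \<and> g ` D \<subseteq> D \<and> g i = j \<and> (\<forall>Y. Y \<subseteq> D \<longrightarrow> P Y \<longrightarrow> P (g ` Y))"
    and P: "\<not> P {}" "P D"
  shows "odd (card {Y. Y \<subseteq> D \<and> P Y})"
proof -
  define A where "A w = {Y. Y \<subseteq> D \<and> P Y \<and> card Y = w}" for w
  have finA: "finite (A w)" for w unfolding A_def using assms(1) by simp
  have even: "even (card (A w))" if w: "0 < w" "w < 2 ^ m" for w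
  proof -
    define C where "C i = {Y \<in> A w. i \<in> Y}" for i
    have le: "card (C i) \<le> card (C j)" if ij: "i \<in> D" "j \<in> D" for i j
    proof -
      obtain g where g: "inj_on g D" "g ` D \<subseteq> D" "g i = j" "\<forall>Y. Y \<subseteq> D \<longrightarrow> P Y \<longrightarrow> P (g ` Y)"
        using trans[OF ij] by blast
      have "inj_on ((`) g) (C i)"
        by (rule inj_on_subset[OF inj_on_image_Pow[OF g(1)]]) (auto simp: C_def A_def)
      moreover have "(`) g ` C i \<subseteq> C j"
        using g by (auto simp: C_def A_def intro: card_image inj_on_subset)
      moreover have "finite (C j)" using finA by (simp add: C_def)
      ultimately show ?thesis by (rule card_inj_on_le)
    qed
    obtain i0 where i0: "i0 \<in> D" using assms(2) by (metis card.empty all_not_in_conv power_not_zero zero_neq_numeral)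
    have "(\<Sum>Y\<in>A w. card Y) = (\<Sum>Y\<in>A w. \<Sum>i\<in>D. if i \<in> Y then 1 else 0)"
      using assms(1) by (intro sum.cong) (auto simp: A_def sum.If_cases Int_absorb1)
    also have "\<dots> = (\<Sum>i\<in>D. \<Sum>Y\<in>A w. if i \<in> Y then 1 else 0)" by (rule sum.swap)
    also have "\<dots> = (\<Sum>i\<in>D. card (C i))"
      using finA by (intro sum.cong) (auto simp: C_def sum.If_cases Int_def)
    also have "\<dots> = (\<Sum>i\<in>D. card (C i0))" using le i0 by (intro sum.cong) (auto intro!: le_antisym)
    finally have "w * card (A w) = 2 ^ m * card (C i0)" using assms(2) by (simp add: A_def mult.commute)
    then have dvd: "2 ^ m dvd w * card (A w)" by simp
    show ?thesis
    proof (rule ccontr)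
      assume "odd (card (A w))"
      then have "coprime (2 ^ m) (card (A w))" by simp
      with dvd have "2 ^ m dvd w" using coprime_dvd_mult_left_iff by blast
      with w show False using nat_dvd_not_less by blast
    qed
  qed
  have "{Y. Y \<subseteq> D \<and> P Y} = (\<Union>w\<in>{..2 ^ m}. A w)"
    using card_mono[OF assms(1)] assms(2) by (auto simp: A_def)
  then have "card {Y. Y \<subseteq> D \<and> P Y} = (\<Sum>w\<in>{..2 ^ m}. card (A w))"
    using finA by (simp only:) (rule card_UN_disjoint, auto simp: A_def)
  also have "\<dots> = card (A (2 ^ m)) + (\<Sum>w\<in>{..<2 ^ m}. card (A w))"
    by (simp add: lessThan_Suc_atMost[symmetric])
  also have "A (2 ^ m) = {D}"
    using assms(1,2) P card_subset_eq[OF assms(1)] by (auto simp: A_def)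
  also have "even (\<Sum>w\<in>{..<2 ^ m}. card (A w))"
  proof (rule dvd_sum)
    fix w :: nat assume w: "w \<in> {..<2 ^ m}"
    have "Y = {}" if "Y \<subseteq> D" "card Y = 0" for Y
      using that finite_subset[OF that(1) assms(1)] by simp
    then have "A 0 = {}" using P by (auto simp: A_def)
    then show "even (card (A w))" using even[of w] w by (cases "w = 0") auto
  qed
  ultimately show ?thesis by simp
qed

section \<open>From an odd number of yes-instances to a query lower bound\<close>

lemma card_even_subsets:
  assumes "finite D" "D \<noteq> {}"
  shows "2 * card {Y. Y \<subseteq> D \<and> even (card Y)} = 2 ^ card D"
proof -
  obtain i where i: "i \<in> D" using assms(2) by auto
  let ?E = "{Y. Y \<subseteq> D \<and> even (card Y)}" and ?O = "{Y. Y \<subseteq> D \<and> odd (card Y)}"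
  have par: "even (card (flip Y i)) \<longleftrightarrow> odd (card Y)" if "Y \<subseteq> D" for Y
    by (rule even_card_flip) (rule finite_subset[OF that assms(1)])
  have "bij_betw (\<lambda>Y. flip Y i) ?E ?O"
    by (rule bij_betwI[where g = "\<lambda>Y. flip Y i"]) (use par flip_subset[OF _ i] in auto)
  then have "card ?E = card ?O" by (rule bij_betw_same_card)
  moreover have "card ?E + card ?O = card (?E \<union> ?O)"
    using assms(1) by (intro card_Un_disjoint[symmetric]) auto
  moreover have "?E \<union> ?O = Pow D" by auto
  ultimately show ?thesis using assms(1) by (simp add: card_Pow)
qed

text \<open>An odd number of yes-instances makes \<open>f\<close> correlate with parity on the cube
  above \<open>G\<close>. So agreement or disagreement with parity holds on more than half of the
  cube, and inside that part each flip changes the value; Huang's weights there feed the adversary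
  bound.\<close>

lemma query_lower_bound:
  assumes I: "finite I" and D: "D \<subseteq> I" "card D = 2 ^ m" and G: "G \<subseteq> I" "G \<inter> D = {}"
    and trans: "\<And>i j. i \<in> D \<Longrightarrow> j \<in> D \<Longrightarrow> \<exists>g. inj_on g D \<and> g ` D \<subseteq> D \<and> g i = j \<and>
      (\<forall>Y. Y \<subseteq> D \<longrightarrow> f (\<lambda>j. j \<in> G \<union> Y) \<longrightarrow> f (\<lambda>j. j \<in> G \<union> g ` Y))"
    and f: "\<not> f (\<lambda>j. j \<in> G)" "f (\<lambda>j. j \<in> G \<union> D)"
    and comp: "computes_bounded I f T"
  shows "sqrt (2 ^ m) \<le> 36 * real T"
proof -
  define P where "P Y = f (\<lambda>j. j \<in> G \<union> Y)" for Y
  have finD: "finite D" using D(1) I finite_subset by blast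
  have D0: "D \<noteq> {}" using D(2) by auto
  have odd_P: "odd (card {Y. Y \<subseteq> D \<and> P Y})"
    using trans f by (intro odd_card_transitive[OF finD D(2)]) (simp_all add: P_def)
  define pe po ne where "pe = card {Y. Y \<subseteq> D \<and> P Y \<and> even (card Y)}"
    and "po = card {Y. Y \<subseteq> D \<and> P Y \<and> odd (card Y)}"
    and "ne = card {Y. Y \<subseteq> D \<and> \<not> P Y \<and> even (card Y)}"
  have un: "card {Y. Y \<subseteq> D \<and> R Y} + card {Y. Y \<subseteq> D \<and> R' Y} = card {Y. Y \<subseteq> D \<and> R'' Y}"
    if "\<And>Y. \<not> (R Y \<and> R' Y)" "\<And>Y. R'' Y \<longleftrightarrow> R Y \<or> R' Y" for R R' R''
  proof -
    have "{Y. Y \<subseteq> D \<and> R'' Y} = {Y. Y \<subseteq> D \<and> R Y} \<union> {Y. Y \<subseteq> D \<and> R' Y}" using that by blast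
    then show ?thesis using that finD by (simp add: card_Un_disjoint disjoint_iff)
  qed
  have a: "pe + po = card {Y. Y \<subseteq> D \<and> P Y}"
    unfolding pe_def po_def by (rule un) blast+
  have b: "pe + ne = card {Y. Y \<subseteq> D \<and> even (card Y)}"
    unfolding pe_def ne_def by (rule un) blast+
  define S' where "S' = {Y. Y \<subseteq> D \<and> (P Y \<longleftrightarrow> odd (card Y))}"
  have d: "po + ne = card S'"
    unfolding po_def ne_def S'_def by (rule un) blast+
  have S': "S' \<subseteq> Pow D" by (auto simp: S'_def)
  have e: "card S' + card (Pow D - S') = 2 ^ card D"
    using card_Diff_subset[OF finite_subset[OF S'] S'] card_mono[OF _ S'] finD by (simp add: card_Pow)
  \<comment> \<open>Were \<open>S'\<close> exactly half the cube, \<open>po + ne\<close> would equal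
    \<open>pe + ne\<close>, against the odd sum \<open>pe + po\<close>.\<close>
  have "pe \<noteq> po" using a odd_P by (metis even_add)
  then have "2 * card S' \<noteq> 2 ^ card D"
    using b d card_even_subsets[OF finD D0] by linarith
  with e have "2 ^ card D < 2 * card S' \<or> 2 ^ card D < 2 * card (Pow D - S')" by linarith
  then obtain S where S: "S \<in> {S', Pow D - S'}" "2 ^ card D < 2 * card S" by blast
  have SD: "S \<subseteq> Pow D" using S(1) S' by blast
  obtain u where u: "\<forall>Y. u Y \<ge> (0::real)" "(\<Sum>Y\<in>S. (u Y)\<^sup>2) > 0"
    "sqrt (card D) * (\<Sum>Y\<in>S. (u Y)\<^sup>2) \<le> (\<Sum>Y\<in>S. \<Sum>i\<in>{i \<in> D. flip Y i \<in> S}. u Y * u (flip Y i))"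
    using huang_weights[OF finD SD S(2) D0] by blast
  have mem: "(P Z \<longleftrightarrow> odd (card Z)) \<longleftrightarrow> S = S'" if Z: "Z \<in> S" for Z
  proof (cases "S = S'")
    case True
    have "Z \<in> S'" using Z True by simp
    then show ?thesis using True by (simp add: S'_def)
  next
    case False
    have "S = Pow D - S'" using S(1) False by simp
    then have "Z \<notin> S'" "Z \<subseteq> D" using Z by simp_all
    then show ?thesis using False by (simp add: S'_def)
  qed
  have sens: "P Y \<noteq> P (flip Y i)" if Y: "Y \<in> S" "i \<in> D" "flip Y i \<in> S" for Y i
  proof -
    have "Y \<subseteq> D" using Y(1) SD by blast
    then have "finite Y" using finD by (rule finite_subset)
    then have "even (card (flip Y i)) \<longleftrightarrow> odd (card Y)" by (rule even_card_flip)
    then show ?thesis using mem[OF Y(1)] mem[OF Y(3)] by metis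
  qed
  have "(\<Sum>Y\<in>S. \<Sum>i\<in>{i \<in> D. flip Y i \<in> S}. u Y * u (flip Y i)) \<le> 36 * real T * (\<Sum>Y\<in>S. (u Y)\<^sup>2)"
    by (rule adversary_bound[where f = f and u = u, OF I D(1) G SD _ _ comp])
      (use u(1) sens in \<open>simp_all only: P_def not_False_eq_True\<close>)
  with u(3) have "sqrt (card D) * (\<Sum>Y\<in>S. (u Y)\<^sup>2) \<le> 36 * real T * (\<Sum>Y\<in>S. (u Y)\<^sup>2)" by (rule order_trans)
  then show ?thesis using u(2) D(2) by simp
qed

section \<open>Reading the whole input\<close>

lemma qstate_cong:
  "(\<And>j. j \<le> k \<Longrightarrow> Us j = Us' j) \<Longrightarrow> qstate I M Us x k = qstate I M Us' x k"
  by (induction k) auto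

lemma apply_op_delta:
  assumes "finite S" "c \<in> S" "\<And>b. b \<in> S \<Longrightarrow> v b = (if b = c then 1 else 0)"
  shows "apply_op S U v a = U a c"
proof -
  have "apply_op S U v a = (\<Sum>b\<in>S. if b = c then U a b else 0)"
    unfolding apply_op_def using assms(3) by (intro sum.cong) auto
  then show ?thesis using assms(1,2) by simp
qed

lemma unitary_on_one: "finite S \<Longrightarrow> unitary_on S (\<lambda>a b. if a = b then 1 else 0)"
proof -
  assume "finite S"
  have "(\<Sum>c\<in>S. (if a = c then 1 else 0) * cnj (if b = c then 1 else 0)) = (\<Sum>c\<in>S. if c = a then (if a = b then 1 else 0) else 0)"
    for a b :: 'a
    by (intro sum.cong) auto
  with \<open>finite S\<close> show ?thesis by (simp add: unitary_on_def)
qed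

lemma unitary_on_permute_rows:
  assumes "unitary_on S U" "inj_on p S" "p ` S \<subseteq> S"
  shows "unitary_on S (\<lambda>a. U (p a))"
  using assms unfolding unitary_on_def by (auto simp: inj_on_eq_iff image_subset_iff)

definition hadamard :: "'i \<Rightarrow> 'i option \<times> nat \<Rightarrow> 'i option \<times> nat \<Rightarrow> complex" where
  "hadamard i a b = (if snd a \<noteq> snd b then 0
     else if fst a \<in> {None, Some i} \<and> fst b \<in> {None, Some i}
       then (if fst a = Some i \<and> fst b = Some i then - 1 else 1) / of_real (sqrt 2)
     else if a = b then 1 else 0)"

lemma sqrt2_square: "complex_of_real (sqrt 2) * complex_of_real (sqrt 2) = 2"
  by (simp flip: of_real_mult)

lemma hadamard_entries:
  "hadamard i b (None, w) = (if snd b = w \<and> fst b \<in> {None, Some i} then 1 / of_real (sqrt 2) else 0)"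
  "hadamard i b (Some i, w) = (if snd b = w \<and> fst b = None then 1 / of_real (sqrt 2)
     else if snd b = w \<and> fst b = Some i then - 1 / of_real (sqrt 2) else 0)"
  by (auto simp: hadamard_def)

lemma hadamard_other:
  assumes "q \<notin> {None, Some i}"
  shows "hadamard i (q, w) c = (if c = (q, w) then 1 else 0)"
    and "hadamard i b (q, w) = (if (q, w) = b then 1 else 0)"
  using assms by (auto simp: hadamard_def prod_eq_iff)

lemma hadamard_sum:
  assumes "finite I" "i \<in> I" "w < M" "q \<in> {None, Some i}"
  shows "(\<Sum>c\<in>qbasis I M. hadamard i (q, w) c * g c)
    = (g (None, w) + (if q = None then 1 else - 1) * g (Some i, w)) / of_real (sqrt 2)"
proof -
  have "(\<Sum>c\<in>qbasis I M. hadamard i (q, w) c * g c)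
    = (\<Sum>c\<in>{(None, w), (Some i, w)}. hadamard i (q, w) c * g c)"
    using assms by (intro sum.mono_neutral_right) (auto simp: qbasis_def hadamard_def)
  then show ?thesis using assms(4) by (auto simp: hadamard_def field_simps)
qed

lemma unitary_on_hadamard:
  assumes "finite I" "i \<in> I"
  shows "unitary_on (qbasis I M) (hadamard i)"
  unfolding unitary_on_def
proof (intro ballI)
  fix a b assume a: "a \<in> qbasis I M" and b: "b \<in> qbasis I M"
  obtain q w where [simp]: "a = (q, w)" by force
  have w: "w < M" using a by (simp add: qbasis_def)
  show "(\<Sum>c\<in>qbasis I M. hadamard i a c * cnj (hadamard i b c)) = (if a = b then 1 else 0)"
  proof (cases "q \<in> {None, Some i}")
    case True
    have "complex_of_real (sqrt 2) \<noteq> 0" by simp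
    with True show ?thesis
      unfolding \<open>a = (q, w)\<close> hadamard_sum[OF assms w True] hadamard_entries
      by (cases b; cases "snd b = w"; cases "fst b = None"; cases "fst b = Some i"; cases "q = None")
        (simp_all add: divide_simps sqrt2_square)
  next
    case False
    then have "(\<Sum>c\<in>qbasis I M. hadamard i a c * cnj (hadamard i b c))
      = (\<Sum>c\<in>qbasis I M. if c = a then cnj (hadamard i b a) else 0)"
      by (intro sum.cong) (simp_all add: hadamard_other)
    also have "\<dots> = cnj (hadamard i b a)" using a assms(1) by simp
    also have "\<dots> = (if a = b then 1 else 0)" using False by (simp add: hadamard_other)
    finally show ?thesis .
  qed
qed

text \<open>Reading the bit \<open>i\<close> with two queries: the first query acts trivially, the second sits between two
  Hadamard gates on \<open>{None, Some i}\<close> and turns the phase into the contents of the query register,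
  which the permutation of basis states then moves to the workspace.\<close>

lemma computes_bounded_exists:
  fixes I :: "'i set"
  assumes I: "finite I"
  shows "\<exists>T. computes_bounded I f T"
proof -
  define M where "M = (2::nat) ^ card I"
  have "card (Pow I) = card {..<M}" using I by (simp add: M_def card_Pow)
  then obtain enc0 where enc0: "bij_betw enc0 (Pow I) {..<M}"
    using I by (metis finite_Pow_iff finite_lessThan finite_same_card_bij)
  define enc where "enc = (\<lambda>K. Transposition.transpose (enc0 {}) 0 (enc0 K))"
  have "enc0 {} < M" "0 < M" using enc0 by (auto simp: bij_betw_def M_def)
  then have "bij_betw (Transposition.transpose (enc0 {}) 0) {..<M} {..<M}"
    by (simp add: bij_betw_def inj_on_def transpose_eq_iff)
      (auto simp: transpose_def image_iff intro: bexI[where x = 0] split: if_splits)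
  then have enc: "bij_betw enc (Pow I) {..<M}"
    using bij_betw_trans[OF enc0] by (simp add: enc_def comp_def)
  have enc_empty: "enc {} = 0" by (simp add: enc_def)
  have enc_lt: "enc K < M" if "K \<subseteq> I" for K using enc that by (auto simp: bij_betw_def)
  have enc_eq: "enc K = enc K' \<longleftrightarrow> K = K'" if "K \<subseteq> I" "K' \<subseteq> I" for K K'
    using enc that by (auto simp: bij_betw_def inj_on_eq_iff)
  define B where "B = qbasis I M"
  have finB: "finite B" using I by (simp add: B_def)
  have enc_B: "(None, enc K) \<in> B" if "K \<subseteq> I" for K using enc_lt[OF that] by (simp add: B_def qbasis_def)
  \<comment> \<open>Invariant: once the bits of \<open>J\<close> are read, the state is the basis
    state with a null query and the code of the ones found in \<open>J\<close>.\<close>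
  have "\<exists>T Us. (\<forall>k\<le>T. unitary_on B (Us k)) \<and> (\<forall>x\<in>inputs I. \<forall>a\<in>B.
     qstate I M Us x T a = (if a = (None, enc {i \<in> J. x i}) then 1 else 0))" if "J \<subseteq> I" for J
    using finite_subset[OF that I] that
  proof (induction J rule: finite_induct)
    case empty
    have *: "(None, 0) \<in> B" using enc_B[of "{}"] enc_empty by simp
    show ?case
    proof (intro exI conjI ballI allI impI)
      show "unitary_on B ((\<lambda>_ a b. if a = b then 1 else 0) k)" for k :: nat
        using unitary_on_one[OF finB] by simp
      show "qstate I M (\<lambda>_ a b. if a = b then 1 else 0) x 0 a = (if a = (None, enc {i \<in> {}. x i}) then 1 else 0)" for x a
        using apply_op_delta[OF finB *, of "\<lambda>a. if a = (None, 0) then 1 else 0"] by (simp add: enc_empty B_def)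
    qed
  next
    case (insert i J)
    then have iI: "i \<in> I" and JI: "J \<subseteq> I" and iJ: "i \<notin> J" by auto
    from insert.IH[OF JI] obtain T Us where Us: "\<forall>k\<le>T. unitary_on B (Us k)" and
      st: "\<And>x a. x \<in> inputs I \<Longrightarrow> a \<in> B \<Longrightarrow> qstate I M Us x T a = (if a = (None, enc {i \<in> J. x i}) then 1 else 0)"
      by blast
    \<comment> \<open>The involution of basis states that exchanges \<open>(Some i, enc K)\<close>
      with \<open>(None, enc (insert i K))\<close> for \<open>K \<subseteq> J\<close>;
      \<open>THE\<close> decodes \<open>K\<close>, and all else is fixed.\<close>
    define p where "p a = (if \<exists>K. K \<subseteq> J \<and> a = (Some i, enc K) then (None, enc (insert i (THE K. K \<subseteq> J \<and> a = (Some i, enc K))))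
      else if \<exists>K. K \<subseteq> J \<and> a = (None, enc (insert i K)) then (Some i, enc (THE K. K \<subseteq> J \<and> a = (None, enc (insert i K)))) else a)" for a
    have p1: "p (Some i, enc K) = (None, enc (insert i K))" if K: "K \<subseteq> J" for K
    proof -
      have "(THE K'. K' \<subseteq> J \<and> (Some i, enc K) = (Some i, enc K')) = K"
        using K JI enc_eq by (intro the_equality) (auto dest: subset_trans)
      then show ?thesis using K unfolding p_def by auto
    qed
    have p2: "p (None, enc (insert i K)) = (Some i, enc K)" if K: "K \<subseteq> J" for K
    proof -
      have uniq: "K' = K" if "K' \<subseteq> J" "enc (insert i K) = enc (insert i K')" for K'
      proof -
        have "insert i K = insert i K'" using that K JI iI by (subst enc_eq[symmetric]) auto
        then show ?thesis using K that iJ by (metis insert_ident subsetD)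
      qed
      have the: "(THE K'. K' \<subseteq> J \<and> enc (insert i K) = enc (insert i K')) = K"
        by (rule the_equality) (use K uniq in blast)+
      have "\<exists>K'. K' \<subseteq> J \<and> enc (insert i K) = enc (insert i K')" using K by blast
      then show ?thesis by (simp add: p_def the)
    qed
    have p3: "p a = a" if "\<not> (\<exists>K. K \<subseteq> J \<and> a = (Some i, enc K))" "\<not> (\<exists>K. K \<subseteq> J \<and> a = (None, enc (insert i K)))" for a
      unfolding p_def if_not_P[OF that(1)] if_not_P[OF that(2)] ..
    have p_cases: thesis
      if "\<And>K. K \<subseteq> J \<Longrightarrow> a = (Some i, enc K) \<Longrightarrow> thesis"
        "\<And>K. K \<subseteq> J \<Longrightarrow> a = (None, enc (insert i K)) \<Longrightarrow> thesis" "p a = a \<Longrightarrow> thesis" for a thesis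
    proof (cases "\<exists>K. K \<subseteq> J \<and> a = (Some i, enc K)")
      case True
      then show thesis using that(1) by (elim exE conjE)
    next
      case not_some: False
      show thesis
      proof (cases "\<exists>K. K \<subseteq> J \<and> a = (None, enc (insert i K))")
        case True
        then show thesis using that(2) by (elim exE conjE)
      next
        case False
        then show thesis by (intro that(3) p3 not_some)
      qed
    qed
    have pp: "p (p a) = a" for a
      by (rule p_cases[of a]) (simp_all add: p1 p2)
    have pB: "p a \<in> B" if a: "a \<in> B" for a
    proof -
      have "(Some i, enc K) \<in> B" "(None, enc (insert i K)) \<in> B" if "K \<subseteq> J" for K
        using that JI iI enc_lt[of K] enc_lt[of "insert i K"] by (auto simp: B_def qbasis_def)
      then show ?thesis using a by (rule_tac p_cases[of a]) (simp_all add: p1 p2)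
    qed
    \<comment> \<open>The permutation is merged into the second Hadamard gate by permuting its rows,
      so exactly two queries are added.\<close>
    define Us' where "Us' k = (if k \<le> T then Us k else if k = Suc T then hadamard i else (\<lambda>a. hadamard i (p a)))" for k
    have "unitary_on B (\<lambda>a. hadamard i (p a))"
      using unitary_on_permute_rows[OF unitary_on_hadamard[OF I iI, of M]] pp pB
      by (metis B_def inj_on_inverseI image_subsetI)
    then have un: "\<forall>k\<le>Suc (Suc T). unitary_on B (Us' k)"
      using Us unitary_on_hadamard[OF I iI, of M] by (auto simp: Us'_def B_def)
    have "qstate I M Us' x (Suc (Suc T)) a = (if a = (None, enc {j \<in> insert i J. x j}) then 1 else 0)"
      if x: "x \<in> inputs I" and a: "a \<in> B" for x a
    proof -
      let ?K = "{j \<in> J. x j}"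
      have K: "?K \<subseteq> J" "?K \<subseteq> I" using JI by auto
      have "qstate I M Us' x T = qstate I M Us x T" by (rule qstate_cong) (simp add: Us'_def)
      then have "phase_oracle x (qstate I M Us' x T) b = (if b = (None, enc ?K) then 1 else 0)" if "b \<in> B" for b
        using st[OF x that] by (cases b) (auto simp: phase_oracle_def split: option.splits)
      then have s1: "qstate I M Us' x (Suc T) b = hadamard i b (None, enc ?K)" for b
        using apply_op_delta[OF finB enc_B[OF K(2)]] by (simp add: Us'_def B_def)
      \<comment> \<open>The basis state reached before the permutation: the bit \<open>x i\<close>
        sits in the query register.\<close>
      define c where "c = (if x i then Some i else None, enc ?K)"
      have s2: "qstate I M Us' x (Suc (Suc T)) a = (if p a = c then 1 else 0)"
      proof -
        obtain q w where pa: "p a = (q, w)" by force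
        have w: "w < M" "(q, w) \<in> B" using pB[OF a] pa by (auto simp: B_def qbasis_def)
        have "qstate I M Us' x (Suc (Suc T)) a
          = (\<Sum>b\<in>qbasis I M. hadamard i (q, w) b * phase_oracle x (qstate I M Us' x (Suc T)) b)"
          by (simp only: qstate.simps(2)[of I M Us' x "Suc T"] apply_op_def) (simp add: Us'_def pa)
        also have "\<dots> = (if (q, w) = c then 1 else 0)"
        proof (cases "q \<in> {None, Some i}")
          case True
          show ?thesis unfolding hadamard_sum[OF I iI w(1) True] phase_oracle_def s1
            using True sqrt2_square by (auto simp: c_def hadamard_def field_simps)
        next
          case False
          have "(\<Sum>b\<in>qbasis I M. hadamard i (q, w) b * phase_oracle x (qstate I M Us' x (Suc T)) b) = 0"
            using False by (intro sum.neutral) (auto simp: phase_oracle_def s1 hadamard_def simp del: qstate.simps)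
          then show ?thesis using False by (auto simp: c_def)
        qed
        finally show ?thesis by (simp add: pa)
      qed
      have "p a = c \<longleftrightarrow> a = p c" using pp by metis
      also have "p c = (None, enc {j \<in> insert i J. x j})"
      proof (cases "x i")
        case True
        then have "{j \<in> insert i J. x j} = insert i ?K" by auto
        then show ?thesis using p1[OF K(1)] True by (simp add: c_def)
      next
        case False
        then have eq: "{j \<in> insert i J. x j} = ?K" by auto
        \<comment> \<open>So \<open>p\<close> fixes the null-query state \<open>c\<close> when the
          bit is zero.\<close>
        have "enc ?K \<noteq> enc (insert i K')" if "K' \<subseteq> J" for K'
          using K(2) that JI iI iJ by (subst enc_eq) auto
        then show ?thesis using False unfolding eq by (subst p3) (auto simp: c_def)
      qed
      finally show ?thesis using s2 by simp
    qed
    with un show ?case by blast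
  qed
  from this[of I] obtain T Us where Us: "\<forall>k\<le>T. unitary_on B (Us k)" and
    st: "\<And>x a. x \<in> inputs I \<Longrightarrow> a \<in> B \<Longrightarrow> qstate I M Us x T a = (if a = (None, enc {i \<in> I. x i}) then 1 else 0)"
    by blast
  define acc :: "'i option \<times> nat \<Rightarrow> bool" where "acc a = (\<exists>K. K \<subseteq> I \<and> a = (None, enc K) \<and> f (\<lambda>i. i \<in> K))" for a
  have "accept_prob I M Us acc x T = (if f x then 1 else 0)" if x: "x \<in> inputs I" for x
  proof -
    let ?K = "{i \<in> I. x i}"
    have xK: "(\<lambda>i. i \<in> ?K) = x" using x by (auto simp: inputs_def)
    have acc: "acc (None, enc ?K) \<longleftrightarrow> f x"
    proof
      assume "acc (None, enc ?K)"
      then obtain K where K: "K \<subseteq> I" "enc ?K = enc K" "f (\<lambda>i. i \<in> K)" unfolding acc_def by auto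
      then have "K = ?K" using enc_eq[of ?K K] by auto
      then show "f x" using K(3) xK by simp
    next
      assume "f x"
      then have "f (\<lambda>i. i \<in> ?K)" unfolding xK .
      then show "acc (None, enc ?K)" unfolding acc_def by (intro exI[of _ ?K]) simp
    qed
    have "(if acc a then (cmod (qstate I M Us x T a))\<^sup>2 else 0)
        = (if a = (None, enc ?K) then (if f x then 1 else 0) else 0)" if a: "a \<in> B" for a
      unfolding st[OF x a] using acc by (cases "a = (None, enc ?K)") simp_all
    then have "accept_prob I M Us acc x T = (\<Sum>a\<in>B. if a = (None, enc ?K) then (if f x then 1 else 0) else 0)"
      unfolding accept_prob_def B_def[symmetric] by (rule sum.cong[OF refl])
    also have "\<dots> = (if f x then 1 else 0)" using finB enc_B[of ?K] by simp
    finally show ?thesis .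
  qed
  moreover have "M \<ge> 1" by (simp add: M_def)
  ultimately have "computes_bounded I f T"
    unfolding computes_bounded_def using Us unfolding B_def by (intro exI[of _ M] exI[of _ Us] exI[of _ acc]) auto
  then show ?thesis ..
qed

text \<open>\<open>Q\<close> is a \<open>LEAST\<close>, which satisfies its predicate once some
  number of queries does.\<close>

lemma computes_bounded_Q: "finite I \<Longrightarrow> computes_bounded I f (Q I f)"
  unfolding Q_def using computes_bounded_exists[of I f] by (blast intro: LeastI_ex)

section \<open>Removing triples between large sets\<close>

definition hom_into :: "nat \<Rightarrow> nat set set \<Rightarrow> nat set set \<Rightarrow> bool" where
  "hom_into n EH E \<longleftrightarrow> (\<exists>h. (\<forall>v<n. h v < n) \<and> (\<forall>e\<in>EH. h ` e \<in> E))"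

lemma finite_triples [simp]: "finite (triples n)"
  by (rule finite_subset[of _ "Pow {..<n}"]) (auto simp: triples_def)

lemma f_hom_iff:
  assumes "E \<subseteq> triples n"
  shows "f_hom n EH (\<lambda>e. e \<in> E) \<longleftrightarrow> hom_into n EH E"
  using assms unfolding f_hom_def hom_into_def triples_def by (intro ex_cong1) auto

lemma hom_into_mono: "hom_into n EH E \<Longrightarrow> E \<subseteq> E' \<Longrightarrow> hom_into n EH E'"
  unfolding hom_into_def by blast

text \<open>Composition with \<open>p\<close>, applied both to symmetries of the target and to the
  collapse of blown-up vertices.\<close>

lemma hom_into_image:
  assumes "hom_into n EH E" "\<And>v. v < n \<Longrightarrow> p v < n" "\<And>e. e \<in> E \<Longrightarrow> p ` e \<in> E'"
  shows "hom_into n EH E'"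
proof -
  obtain h where h: "\<forall>v<n. h v < n" "\<forall>e\<in>EH. h ` e \<in> E" using assms(1) unfolding hom_into_def by blast
  then have "\<forall>v<n. (p \<circ> h) v < n" "\<forall>e\<in>EH. (p \<circ> h) ` e \<in> E'"
    unfolding image_comp[symmetric] o_apply using assms(2,3) by blast+
  then show ?thesis unfolding hom_into_def by blast
qed

text \<open>For disjoint sets these are the transversal triples. Phrasing by intersections makes
  growth in one argument and invariance under permutations immediate.\<close>

definition box :: "nat \<Rightarrow> nat set \<Rightarrow> nat set \<Rightarrow> nat set \<Rightarrow> nat set set" where
  "box n X Y Z = {e \<in> triples n. e \<inter> X \<noteq> {} \<and> e \<inter> Y \<noteq> {} \<and> e \<inter> Z \<noteq> {}}"

lemma box_eq_image:
  assumes "X \<subseteq> {..<n}" "Y \<subseteq> {..<n}" "Z \<subseteq> {..<n}" "X \<inter> Y = {}" "X \<inter> Z = {}" "Y \<inter> Z = {}"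
  shows "box n X Y Z = (\<lambda>(x, y, z). {x, y, z}) ` (X \<times> Y \<times> Z)"
proof (intro equalityI subsetI)
  fix e assume "e \<in> box n X Y Z"
  then obtain x y z where xyz: "x \<in> e" "x \<in> X" "y \<in> e" "y \<in> Y" "z \<in> e" "z \<in> Z" and e: "card e = 3"
    by (auto simp: box_def triples_def)
  have "x \<noteq> y" "x \<noteq> z" "y \<noteq> z" using xyz assms by blast+
  then have "card {x, y, z} = 3" by simp
  then have "{x, y, z} = e" using e xyz by (intro card_subset_eq) (auto intro: card_ge_0_finite)
  then show "e \<in> (\<lambda>(x, y, z). {x, y, z}) ` (X \<times> Y \<times> Z)" using xyz by force
next
  fix e assume "e \<in> (\<lambda>(x, y, z). {x, y, z}) ` (X \<times> Y \<times> Z)"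
  then obtain x y z where xyz: "e = {x, y, z}" "x \<in> X" "y \<in> Y" "z \<in> Z" by auto
  moreover from this have "x \<noteq> y" "x \<noteq> z" "y \<noteq> z" using assms by blast+
  ultimately have "card e = 3" by simp
  then show "e \<in> box n X Y Z" using xyz assms by (auto simp: box_def triples_def)
qed

lemma card_box:
  assumes "X \<subseteq> {..<n}" "Y \<subseteq> {..<n}" "Z \<subseteq> {..<n}" "X \<inter> Y = {}" "X \<inter> Z = {}" "Y \<inter> Z = {}"
  shows "card (box n X Y Z) = card X * card Y * card Z"
proof -
  have "x = x' \<and> y = y' \<and> z = z'" if eq: "{x, y, z} = {x', y', z'}"
    and *: "x \<in> X" "y \<in> Y" "z \<in> Z" "x' \<in> X" "y' \<in> Y" "z' \<in> Z" for x y z x' y' z'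
  proof -
    have "{x, y, z} \<inter> X = {x}" "{x', y', z'} \<inter> X = {x'}" "{x, y, z} \<inter> Y = {y}"
      "{x', y', z'} \<inter> Y = {y'}" "{x, y, z} \<inter> Z = {z}" "{x', y', z'} \<inter> Z = {z'}"
      using * assms by blast+
    then show ?thesis unfolding eq by auto
  qed
  then have "inj_on (\<lambda>(x, y, z). {x, y, z}) (X \<times> Y \<times> Z)"
    unfolding inj_on_def by (simp add: Ball_def split_paired_All)
  then show ?thesis unfolding box_eq_image[OF assms] by (simp add: card_image card_cartesian_product)
qed

text \<open>Weaker than invariance under all permutations of \<open>W\<close>, so that translations
  of labels suffice in the chain of cliques below.\<close>

definition transitive_preserving :: "nat set \<Rightarrow> nat set set \<Rightarrow> bool" where
  "transitive_preserving W G \<longleftrightarrow>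
     (\<forall>w\<in>W. \<forall>w'\<in>W. \<exists>p. p permutes W \<and> p w = w' \<and> (\<forall>e\<in>G. p ` e \<in> G))"

lemma transitive_preservingI:
  assumes "\<And>p e. p permutes W \<Longrightarrow> e \<in> G \<Longrightarrow> p ` e \<in> G"
  shows "transitive_preserving W G"
  unfolding transitive_preserving_def
proof (intro ballI)
  fix w w' assume "w \<in> W" "w' \<in> W"
  then show "\<exists>p. p permutes W \<and> p w = w' \<and> (\<forall>e\<in>G. p ` e \<in> G)"
    using assms permutes_swap_id[of w W w'] by (intro exI[of _ "Transposition.transpose w w'"]) auto
qed

lemma permutes_image_eq:
  assumes "p permutes W" "W \<subseteq> X \<or> W \<inter> X = {}"
  shows "p ` X = X"
  using assms(2)
proof
  assume "W \<subseteq> X"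
  then show ?thesis using assms(1) by (metis permutes_image permutes_subset)
next
  assume "W \<inter> X = {}"
  then have "p x = x" if "x \<in> X" for x using that assms(1) by (auto simp: permutes_def)
  then show ?thesis by simp
qed

lemma permutes_image_Int:
  assumes "p permutes W" "W \<subseteq> X \<or> W \<inter> X = {}"
  shows "p ` e \<inter> X = p ` (e \<inter> X)"
  using permutes_image_eq[OF assms] image_Int[OF permutes_inj[OF assms(1)]] by metis

lemma permutes_triples:
  assumes "p permutes W" "W \<subseteq> {..<n}" "e \<in> triples n"
  shows "p ` e \<in> triples n"
proof -
  have "p ` e \<subseteq> p ` {..<n}" using assms(3) by (auto simp: triples_def)
  then have "p ` e \<subseteq> {..<n}" using permutes_image_eq[OF assms(1)] assms(2) by blast
  moreover have "card (p ` e) = card e"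
    by (rule card_image) (metis assms(1) permutes_inj inj_on_subset subset_UNIV)
  ultimately show ?thesis using assms(3) by (simp add: triples_def)
qed

section \<open>Deletions of triples forced by an algorithm with few queries\<close>

locale fast_hom_algorithm =
  fixes n :: nat and EH :: "nat set set" and T :: nat
  assumes computes: "computes_bounded (triples n) (f_hom n EH) T"
begin

text \<open>Otherwise \<open>G\<close> is a no-instance that becomes a yes-instance by adding the
  whole box. Composed symmetries of the three sets act transitively on the box, so
  \<open>query_lower_bound\<close> contradicts \<open>small\<close>.\<close>

lemma box_removable:
  assumes sub: "X \<subseteq> {..<n}" "Y \<subseteq> {..<n}" "Z \<subseteq> {..<n}"
    and disj: "X \<inter> Y = {}" "X \<inter> Z = {}" "Y \<inter> Z = {}"
    and card: "card X = 2 ^ a" "card Y = 2 ^ b" "card Z = 2 ^ c"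
    and small: "36 * real T < sqrt (2 ^ (a + b + c))"
    and G: "G \<subseteq> triples n" "G \<inter> box n X Y Z = {}"
    and tr: "transitive_preserving X G" "transitive_preserving Y G" "transitive_preserving Z G"
    and hom: "hom_into n EH (G \<union> box n X Y Z)"
  shows "hom_into n EH G"
proof (rule ccontr)
  assume no: "\<not> hom_into n EH G"
  let ?D = "box n X Y Z"
  have D: "?D \<subseteq> triples n" by (auto simp: box_def)
  have cardD: "card ?D = 2 ^ (a + b + c)" using card_box[OF sub disj] card by (simp add: power_add)
  have "\<exists>g. inj_on g ?D \<and> g ` ?D \<subseteq> ?D \<and> g i = j \<and>
      (\<forall>F. F \<subseteq> ?D \<longrightarrow> f_hom n EH (\<lambda>j. j \<in> G \<union> F) \<longrightarrow> f_hom n EH (\<lambda>j. j \<in> G \<union> g ` F))"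
    if ij: "i \<in> ?D" "j \<in> ?D" for i j
  proof -
    obtain x y z where i: "i = {x, y, z}" "x \<in> X" "y \<in> Y" "z \<in> Z"
      using ij(1) unfolding box_eq_image[OF sub disj] by auto
    obtain x' y' z' where j: "j = {x', y', z'}" "x' \<in> X" "y' \<in> Y" "z' \<in> Z"
      using ij(2) unfolding box_eq_image[OF sub disj] by auto
    obtain px where px: "px permutes X" "px x = x'" "\<forall>e\<in>G. px ` e \<in> G"
      using tr(1) i j unfolding transitive_preserving_def by blast
    obtain py where py: "py permutes Y" "py y = y'" "\<forall>e\<in>G. py ` e \<in> G"
      using tr(2) i j unfolding transitive_preserving_def by blast
    obtain pz where pz: "pz permutes Z" "pz z = z'" "\<forall>e\<in>G. pz ` e \<in> G"
      using tr(3) i j unfolding transitive_preserving_def by blast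
    have pxZ: "px v = v" if "v \<notin> X" for v using px(1) that by (simp add: permutes_def)
    have pyZ: "py v = v" if "v \<notin> Y" for v using py(1) that by (simp add: permutes_def)
    have pzZ: "pz v = v" if "v \<notin> Z" for v using pz(1) that by (simp add: permutes_def)
    \<comment> \<open>The three permutations move disjoint sets, so \<open>p\<close> acts on each
      set as its own permutation and sends \<open>i\<close> to \<open>j\<close>.\<close>
    define p where "p = px \<circ> py \<circ> pz"
    have p: "p permutes {..<n}" unfolding p_def
      using px(1) py(1) pz(1) sub by (intro permutes_compose) (blast intro: permutes_subset)+
    have pX: "p v = px v" if "v \<in> X" for v
      unfolding p_def comp_def by (metis that disj disjoint_iff pyZ pzZ)
    have pY: "p v = py v" if "v \<in> Y" for v
      unfolding p_def comp_def using that py(1) by (metis disj disjoint_iff permutes_in_image pxZ pzZ)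
    have pZ: "p v = pz v" if "v \<in> Z" for v
      unfolding p_def comp_def using that pz(1) by (metis disj disjoint_iff permutes_in_image pxZ pyZ)
    have pG: "p ` e \<in> G" if "e \<in> G" for e
      using that px(3) py(3) pz(3) by (simp only: p_def image_comp[symmetric])
    have pD: "p ` e \<in> ?D" if e: "e \<in> ?D" for e
    proof -
      obtain u v w where "e = {u, v, w}" "u \<in> X" "v \<in> Y" "w \<in> Z"
        using e unfolding box_eq_image[OF sub disj] by auto
      moreover from this have "px u \<in> X" "py v \<in> Y" "pz w \<in> Z"
        using px(1) py(1) pz(1) by (simp_all add: permutes_in_image)
      ultimately show ?thesis unfolding box_eq_image[OF sub disj] using pX pY pZ by force
    qed
    show ?thesis
    proof (intro exI[of _ "(`) p"] conjI allI impI)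
      show "inj_on ((`) p) ?D"
        by (rule inj_on_subset[OF inj_on_image_Pow[OF permutes_inj[OF p]]]) simp
      show "(`) p ` ?D \<subseteq> ?D" using pD by auto
      show "p ` i = j" using i j pX pY pZ px(2) py(2) pz(2) by auto
      fix F assume F: "F \<subseteq> ?D" and hF: "f_hom n EH (\<lambda>j. j \<in> G \<union> F)"
      have "(`) p ` F \<subseteq> ?D" using F pD by auto
      moreover have "hom_into n EH (G \<union> F)" using hF f_hom_iff[of "G \<union> F" n EH] G(1) F D by blast
      then have "hom_into n EH (G \<union> (`) p ` F)"
        by (rule hom_into_image[where p = p]) (use pG permutes_in_image[OF p] in auto)
      ultimately show "f_hom n EH (\<lambda>j. j \<in> G \<union> (`) p ` F)"
        using f_hom_iff[of "G \<union> (`) p ` F" n EH] G(1) D by blast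
    qed
  qed
  then have "sqrt (2 ^ (a + b + c)) \<le> 36 * real T"
    using no hom f_hom_iff[OF G(1), of EH] f_hom_iff[of "G \<union> ?D" n EH] G D cardD
    by (intro query_lower_bound[OF finite_triples D cardD G(1) G(2) _ _ _ computes]) auto
  then show False using small by simp
qed

text \<open>The size of \<open>C\<close> may fail to be a power of two, so \<open>C\<close> is
  treated one vertex at a time: a new vertex \<open>w\<close> is completed to a set \<open>D\<close>
  of size \<open>2 ^ k\<close>, and the whole box over \<open>D\<close> is removed.\<close>

lemma all_box_removable:
  assumes sub: "A \<subseteq> {..<n}" "B \<subseteq> {..<n}" "C \<subseteq> {..<n}"
    and disj: "A \<inter> B = {}" "A \<inter> C = {}" "B \<inter> C = {}"
    and card: "card A = 2 ^ k" "card B = 2 ^ k" "card C \<ge> 2 ^ k"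
    and small: "36 * real T < sqrt (2 ^ (k + k + k))"
    and hom: "hom_into n EH (triples n)"
  shows "hom_into n EH (triples n - box n A B C)"
proof -
  have finC: "finite C" using sub(3) finite_subset by blast
  have "U \<subseteq> C \<Longrightarrow> hom_into n EH (triples n - box n A B U)" if "finite U" for U
    using that
  proof (induction U rule: finite_induct)
    case empty
    then show ?case using hom by (simp add: box_def)
  next
    case (insert w U)
    have "1 \<le> (2::nat) ^ k" by simp
    then have "2 ^ k - 1 \<le> card (C - {w})" using card(3) insert.prems finC by simp
    then obtain D' where D': "D' \<subseteq> C - {w}" "card D' = 2 ^ k - 1" "finite D'"
      by (rule obtain_subset_with_card_n)
    define D where "D = insert w D'"
    have "w \<notin> D'" using D' by blast
    then have "card D = 2 ^ k" using D' \<open>1 \<le> 2 ^ k\<close> by (simp add: D_def)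
    then have D: "D \<subseteq> C" "card D = 2 ^ k" "w \<in> D" using D' insert.prems by (auto simp: D_def)
    \<comment> \<open>Vertices of \<open>D\<close> outside \<open>insert w U\<close> lose their
      triples here too, which keeps \<open>G\<close> invariant under permutations of
      \<open>D\<close>; monotonicity returns these triples at the end.\<close>
    define G where "G = triples n - box n A B (U \<union> D)"
    have DU: "A \<inter> (U \<union> D) = {}" "B \<inter> (U \<union> D) = {}" using disj D insert.prems by auto
    have inv: "p ` e \<in> G" if W: "W \<in> {A, B, D}" and p: "p permutes W" and e: "e \<in> G" for W p e
    proof -
      have WX: "W \<subseteq> X \<or> W \<inter> X = {}" if "X \<in> {A, B, U \<union> D}" for X
        using W that disj DU D by auto
      have "p ` e \<in> triples n" using W p e sub D by (intro permutes_triples[OF p]) (auto simp: G_def)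
      then show ?thesis using e WX by (auto simp: G_def box_def permutes_image_Int[OF p])
    qed
    have "hom_into n EH (triples n - box n A B U)" using insert by simp
    then have "hom_into n EH (G \<union> box n A B D)"
      by (rule hom_into_mono) (auto simp: G_def box_def)
    then have "hom_into n EH G"
      using sub D disj card small
      by (intro box_removable[of A B D k k k G] transitive_preservingI inv) (auto simp: G_def box_def)
    then show ?case by (rule hom_into_mono) (use D in \<open>auto simp: G_def box_def\<close>)
  qed
  then show ?thesis using finC by blast
qed

text \<open>For disjoint \<open>A\<close> and \<open>B\<close> the inequality is an equality: two
  vertices in \<open>A\<close> and one in \<open>B\<close>.\<close>

definition pair_box :: "nat set \<Rightarrow> nat set \<Rightarrow> nat set set" where
  "pair_box A B = {e \<in> triples n. 2 \<le> card (e \<inter> A) \<and> e \<inter> B \<noteq> {}}"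

text \<open>Rivest and Vuillemin's chain of disjoint unions of cliques: with \<open>A\<close> labelled by the subsets of
  \<open>{..<k}\<close>, the cliques at level \<open>j\<close> consist of the labels that agree on \<open>{j..<k}\<close>, and passing
  from level \<open>j + 1\<close> to level \<open>j\<close> only deletes pairs whose labels differ in \<open>j\<close>.\<close>

lemma pair_box_removable:
  assumes sub: "A \<subseteq> {..<n}" "B \<subseteq> {..<n}" and disj: "A \<inter> B = {}"
    and card: "card A = 2 ^ k" "card B = 2 ^ b"
    and small: "36 * real T < sqrt (2 ^ (2 * (k - 1) + b))"
    and G: "G \<subseteq> triples n" "G \<inter> pair_box A B = {}"
    and inv: "\<And>p e. p permutes A \<Longrightarrow> e \<in> G \<Longrightarrow> p ` e \<in> G" "\<And>p e. p permutes B \<Longrightarrow> e \<in> G \<Longrightarrow> p ` e \<in> G"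
    and hom: "hom_into n EH (G \<union> pair_box A B)"
  shows "hom_into n EH G"
proof -
  have finA: "finite A" using sub(1) finite_subset by blast
  have "card A = card (Pow {..<k})" using card by (simp add: card_Pow)
  then obtain l where l: "bij_betw l A (Pow {..<k})"
    using finA by (metis finite_Pow_iff finite_lessThan finite_same_card_bij)
  have l_in: "l a \<subseteq> {..<k}" if "a \<in> A" for a using l that by (auto simp: bij_betw_def)
  have l_inj: "a = a'" if "l a = l a'" "a \<in> A" "a' \<in> A" for a a' using l that by (auto simp: bij_betw_def inj_on_def)
  \<comment> \<open>Level \<open>k\<close> is all of \<open>pair_box A B\<close>, and level
    \<open>0\<close> is empty because labels determine vertices.\<close>
  define R where "R j = {e \<in> pair_box A B. \<forall>u\<in>e \<inter> A. \<forall>v\<in>e \<inter> A. l u \<inter> {j..<k} = l v \<inter> {j..<k}}" for j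
  have RI: "e \<in> R j" if "e \<in> pair_box A B"
    "\<And>u v. u \<in> e \<inter> A \<Longrightarrow> v \<in> e \<inter> A \<Longrightarrow> l u \<inter> {j..<k} = l v \<inter> {j..<k}" for e j
    unfolding R_def using that by blast
  have R_pair_box: "R j \<subseteq> pair_box A B" for j unfolding R_def by blast
  have R_agree: "l u \<inter> {j..<k} = l v \<inter> {j..<k}" if "e \<in> R j" "u \<in> e \<inter> A" "v \<in> e \<inter> A" for e j u v
    using that unfolding R_def by blast
  have step: "hom_into n EH (G \<union> R j)" if j: "j < k" and h: "hom_into n EH (G \<union> R (Suc j))" for j
  proof -
    define X where "X c = {a \<in> A. (j \<in> l a) = c}" for c
    have XA: "X c \<subseteq> A" for c by (auto simp: X_def)
    have finX: "finite (X c)" for c using XA finA finite_subset by blast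
    have kk: "2 ^ k = 2 * (2::nat) ^ (k - 1)" using j by (cases k) simp_all
    have "card (X False) = card {Y. Y \<subseteq> {..<k} \<and> j \<notin> Y}"
    proof (rule bij_betw_same_card[OF bij_betw_subset[OF l]])
      have "l ` X False = {Y \<in> l ` A. j \<notin> Y}" by (auto simp: X_def)
      then show "l ` X False = {Y. Y \<subseteq> {..<k} \<and> j \<notin> Y}"
        using l by (simp add: bij_betw_def)
    qed (rule XA)
    then have cF: "card (X False) = 2 ^ (k - 1)" using card_Pow_notin[of "{..<k}" j] j kk by simp
    have "A = X False \<union> X True" by (auto simp: X_def)
    then have "card A = card (X False) + card (X True)"
      using card_Un_disjoint[OF finX finX, of False True] by (auto simp: X_def)
    then have cT: "card (X True) = 2 ^ (k - 1)" using cF card kk by simp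
    have trX: "transitive_preserving (X c) (G \<union> R j)" for c
      unfolding transitive_preserving_def
    proof (intro ballI)
      fix x x' assume x: "x \<in> X c" "x' \<in> X c"
      \<comment> \<open>Translation of labels by the symmetric difference \<open>m\<close> carries
        \<open>x\<close> to \<open>x'\<close>; both labels agree about \<open>j\<close>, so
        \<open>j \<notin> m\<close> and \<open>X c\<close> is preserved.\<close>
      define m where "m = (l x - l x') \<union> (l x' - l x)"
      define p where "p v = (if v \<in> X c then inv_into A l ((l v - m) \<union> (m - l v)) else v)" for v
      have m: "m \<subseteq> {..<k}" "j \<notin> m" using x l_in by (auto simp: m_def X_def)
      have lp: "l (p v) = (l v - m) \<union> (m - l v)" "p v \<in> A" if v: "v \<in> X c" for v
      proof -
        have "(l v - m) \<union> (m - l v) \<in> l ` A" using l v m l_in[of v] XA by (auto simp: bij_betw_def)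
        then show "l (p v) = (l v - m) \<union> (m - l v)" "p v \<in> A"
          using v by (simp_all add: p_def f_inv_into_f inv_into_into)
      qed
      have pX: "p v \<in> X c" if v: "v \<in> X c" for v
        using lp[OF v] m v by (auto simp: X_def)
      have pp: "p (p v) = v" if v: "v \<in> X c" for v
        using lp[OF v] lp[OF pX[OF v]] v XA by (intro l_inj) auto
      have p: "p permutes X c"
      proof (rule bij_imp_permutes)
        show "bij_betw p (X c) (X c)" by (rule bij_betwI[where g = p]) (use pX pp in auto)
      qed (simp add: p_def)
      have "p x = x'"
      proof (rule l_inj)
        show "l (p x) = l x'" using lp[OF x(1)] by (auto simp: m_def)
      qed (use lp(2)[OF x(1)] x(2) in \<open>simp_all add: X_def\<close>)
      moreover have "p ` e \<in> G \<union> R j" if e: "e \<in> G \<union> R j" for e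
      proof (cases "e \<in> G")
        case True
        then show ?thesis using inv(1) permutes_subset[OF p XA] by blast
      next
        case False
        then have eR: "e \<in> R j" using e by simp
        then have eP: "e \<in> pair_box A B" using R_pair_box by blast
        have eA: "p ` e \<inter> A = p ` (e \<inter> A)" and eB: "p ` e \<inter> B = p ` (e \<inter> B)"
          using XA[of c] disj by (auto intro!: permutes_image_Int[OF p])
        have "card (p ` (e \<inter> A)) = card (e \<inter> A)"
          by (rule card_image) (metis p permutes_inj inj_on_subset subset_UNIV)
        moreover have "p ` e \<in> triples n"
          using eP XA sub by (intro permutes_triples[OF p]) (auto simp: pair_box_def)
        ultimately have "p ` e \<in> pair_box A B" using eP by (simp add: pair_box_def eA eB)
        moreover have "l (p u) \<inter> {j..<k} = l (p v) \<inter> {j..<k}" if uv: "u \<in> e \<inter> A" "v \<in> e \<inter> A" for u v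
        proof -
          have agree: "l u \<inter> {j..<k} = l v \<inter> {j..<k}" by (rule R_agree[OF eR uv])
          then have "j \<in> l u \<inter> {j..<k} \<longleftrightarrow> j \<in> l v \<inter> {j..<k}" by simp
          \<comment> \<open>A pair agreeing on \<open>{j..<k}\<close> lies inside or outside
            \<open>X c\<close> as a whole, so both labels are translated by \<open>m\<close> or
            neither is.\<close>
          then have iff: "u \<in> X c \<longleftrightarrow> v \<in> X c" using uv j by (simp add: X_def)
          show ?thesis
          proof (cases "u \<in> X c")
            case True
            show ?thesis unfolding lp(1)[OF True] lp(1)[OF iff[THEN iffD1, OF True]] using agree by blast
          next
            case False
            then show ?thesis using agree iff by (simp add: p_def)
          qed
        qed
        ultimately have "p ` e \<in> R j" by (intro RI) (auto simp only: eA)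
        then show ?thesis by blast
      qed
      ultimately show "\<exists>p. p permutes X c \<and> p x = x' \<and> (\<forall>e\<in>G \<union> R j. p ` e \<in> G \<union> R j)"
        using p by blast
    qed
    have trB: "transitive_preserving B (G \<union> R j)"
    proof (rule transitive_preservingI)
      fix p e assume p: "p permutes B" and e: "e \<in> G \<union> R j"
      show "p ` e \<in> G \<union> R j"
      proof (cases "e \<in> G")
        case True
        then show ?thesis using inv(2) p by blast
      next
        case False
        then have eR: "e \<in> R j" using e by simp
        then have eP: "e \<in> pair_box A B" using R_pair_box by blast
        have "p u = u" if "u \<in> A" for u using p that disj by (auto simp: permutes_def)
        then have eA: "p ` e \<inter> A = e \<inter> A" using permutes_image_Int[OF p, of A e] disj by auto
        have eB: "p ` e \<inter> B = p ` (e \<inter> B)" by (rule permutes_image_Int[OF p]) simp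
        have "p ` e \<in> triples n"
          using eP sub by (intro permutes_triples[OF p]) (auto simp: pair_box_def)
        then have "p ` e \<in> pair_box A B" using eP by (simp add: pair_box_def eA eB)
        then have "p ` e \<in> R j" by (rule RI) (rule R_agree[OF eR], simp_all only: eA)
        then show ?thesis by blast
      qed
    qed
    have boxsub: "box n (X False) (X True) B \<subseteq> pair_box A B - R j"
    proof
      fix e assume e: "e \<in> box n (X False) (X True) B"
      then obtain u v where uv: "u \<in> e" "u \<in> X False" "v \<in> e" "v \<in> X True" by (auto simp: box_def)
      then have "u \<noteq> v" by (auto simp: X_def)
      moreover have "finite e" using e by (auto simp: box_def triples_def intro: card_ge_0_finite)
      ultimately have "2 \<le> card (e \<inter> A)"
        using uv card_mono[of "e \<inter> A" "{u, v}"] by (simp add: X_def)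
      then have "e \<in> pair_box A B" using e by (simp add: box_def pair_box_def)
      moreover have "j \<notin> l u \<inter> {j..<k}" "j \<in> l v \<inter> {j..<k}" "u \<in> A" "v \<in> A"
        using uv j by (simp_all add: X_def)
      then have "e \<notin> R j" using R_agree[of e j u v] uv(1,3) by (metis IntI)
      ultimately show "e \<in> pair_box A B - R j" by blast
    qed
    have "R (Suc j) \<subseteq> R j \<union> box n (X False) (X True) B"
    proof
      fix e assume e: "e \<in> R (Suc j)"
      show "e \<in> R j \<union> box n (X False) (X True) B"
      proof (rule ccontr)
        assume "e \<notin> R j \<union> box n (X False) (X True) B"
        then have *: "e \<notin> R j" "e \<notin> box n (X False) (X True) B" by auto
        have eP: "e \<in> pair_box A B" using e R_pair_box by blast
        obtain u v where uv: "u \<in> e \<inter> A" "v \<in> e \<inter> A" "l u \<inter> {j..<k} \<noteq> l v \<inter> {j..<k}"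
          using RI[OF eP] * by blast
        have "l u \<inter> {Suc j..<k} = l v \<inter> {Suc j..<k}" using R_agree[OF e uv(1,2)] .
        moreover have "{j..<k} = insert j {Suc j..<k}" using j by auto
        ultimately have "(j \<in> l u) \<noteq> (j \<in> l v)" using uv(3) by (metis Int_insert_right)
        then have "e \<inter> X False \<noteq> {} \<and> e \<inter> X True \<noteq> {}"
          using uv(1,2) by (cases "j \<in> l u") (auto simp: X_def)
        then show False using eP *(2) by (simp add: pair_box_def box_def)
      qed
    qed
    \<comment> \<open>The box may also cover pairs whose labels differ above \<open>j\<close> as
      well; adding such triples preserves a homomorphism, and the box stays disjoint from
      \<open>G \<union> R j\<close>.\<close>
    then have "hom_into n EH ((G \<union> R j) \<union> box n (X False) (X True) B)"
      using h by (elim hom_into_mono) auto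
    moreover have "G \<union> R j \<subseteq> triples n" using G(1) R_pair_box by (auto simp: pair_box_def)
    moreover have "(G \<union> R j) \<inter> box n (X False) (X True) B = {}" using boxsub G(2) by blast
    moreover have "X False \<subseteq> {..<n}" "X True \<subseteq> {..<n}" "X False \<inter> X True = {}" "X False \<inter> B = {}" "X True \<inter> B = {}"
      using sub(1) disj by (auto simp: X_def)
    ultimately show ?thesis
      using small sub(2) cF cT card(2) trX trB
      by (intro box_removable[of "X False" "X True" B "k - 1" "k - 1" b "G \<union> R j"])
        (simp_all add: mult_2)
  qed
  have "R k = pair_box A B" by (simp add: R_def)
  then have "hom_into n EH (G \<union> R k)" using hom by simp
  then have "hom_into n EH (G \<union> R (k - i))" for i
  proof (induction i)
    case (Suc i)
    show ?case
    proof (cases "i < k")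
      case True
      then have "Suc (k - Suc i) = k - i" by simp
      then show ?thesis using step[of "k - Suc i"] Suc True by simp
    next
      case False
      then show ?thesis using Suc by simp
    qed
  qed simp
  from this[of k] have "hom_into n EH (G \<union> R 0)" by simp
  moreover have "R 0 = {}"
  proof (rule ccontr)
    assume "R 0 \<noteq> {}"
    then obtain e where e: "e \<in> R 0" by auto
    have "u = v" if "u \<in> e \<inter> A" "v \<in> e \<inter> A" for u v
    proof (rule l_inj)
      have "l u \<inter> {0..<k} = l v \<inter> {0..<k}" using R_agree[OF e that] .
      then show "l u = l v" using l_in[of u] l_in[of v] that by (auto simp: atLeast0LessThan)
    qed (use that in auto)
    then have "card (e \<inter> A) \<le> 1" by (metis card_le_Suc0_iff_eq finA finite_Int One_nat_def)
    moreover have "e \<in> pair_box A B" using e R_pair_box by blast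
    ultimately show False by (simp add: pair_box_def)
  qed
  ultimately show ?thesis by simp
qed

end

section \<open>Colorings of the pattern\<close>

context fast_hom_algorithm
begin

text \<open>Deleting the triples that meet \<open>A\<close>, \<open>B\<close> and \<open>C\<close>,
  then those with two vertices in \<open>A\<close> and one in \<open>B\<close>, then the converse,
  leaves none meeting both \<open>A\<close> and \<open>B\<close>. Shifting \<open>A\<close> onto
  \<open>B\<close> is then injective on the image of every edge and saves \<open>2 ^ k\<close>
  values.\<close>

lemma strongly_colorable_with_fewer_colors:
  assumes q: "3 * 2 ^ k \<le> n" and small: "36 * real T < sqrt (2 ^ (2 * (k - 1) + k))"
    and EH: "EH \<subseteq> triples n"
  shows "\<exists>h. (\<forall>v<n. h v < n) \<and> card (h ` {..<n}) \<le> n - 2 ^ k \<and> (\<forall>e\<in>EH. card (h ` e) = 3)"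
proof -
  define q :: nat where "q = 2 ^ k"
  define A B C where "A = {..<q}" and "B = {q..<2 * q}" and "C = {2 * q..<n}"
  have q3: "3 * q \<le> n" using q by (simp add: q_def)
  have sub: "A \<subseteq> {..<n}" "B \<subseteq> {..<n}" "C \<subseteq> {..<n}" using q3 by (auto simp: A_def B_def C_def)
  have disj: "A \<inter> B = {}" "A \<inter> C = {}" "B \<inter> C = {}" by (auto simp: A_def B_def C_def)
  have card: "card A = 2 ^ k" "card B = 2 ^ k" "card C \<ge> 2 ^ k"
    using q3 by (simp_all add: A_def B_def C_def q_def)
  have "sqrt (2 ^ (2 * (k - 1) + k)) \<le> sqrt (2 ^ (k + k + k))"
    by (intro real_sqrt_le_mono power_increasing) auto
  with small have small3: "36 * real T < sqrt (2 ^ (k + k + k))" by (rule less_le_trans)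
  define G1 where "G1 = triples n - box n A B C"
  define G2 where "G2 = G1 - pair_box A B"
  define G3 where "G3 = G2 - pair_box B A"
  have "\<forall>e\<in>EH. id ` e \<in> triples n" using EH by auto
  then have "hom_into n EH (triples n)" unfolding hom_into_def by (intro exI[of _ id]) simp
  then have h1: "hom_into n EH G1"
    unfolding G1_def by (rule all_box_removable[OF sub disj card small3])
  have inv: "p ` e \<in> G1 \<and> (e \<in> G2 \<longrightarrow> p ` e \<in> G2) \<and> (e \<in> G3 \<longrightarrow> p ` e \<in> G3)"
    if W: "W \<in> {A, B}" and p: "p permutes W" and e: "e \<in> G1" for W p e
  proof -
    have WX: "W \<subseteq> X \<or> W \<inter> X = {}" if "X \<in> {A, B, C}" for X
      using W that disj by auto
    have eX: "p ` e \<inter> X = p ` (e \<inter> X)" if "X \<in> {A, B, C}" for X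
      by (rule permutes_image_Int[OF p WX[OF that]])
    have card: "card (p ` F) = card F" for F
      by (rule card_image[OF inj_on_subset[OF permutes_inj[OF p]]]) simp
    have tr: "p ` e \<in> triples n" using W p e sub by (intro permutes_triples[OF p]) (auto simp: G1_def)
    then have "p ` e \<in> box n A B C \<longleftrightarrow> e \<in> box n A B C" "p ` e \<in> pair_box A B \<longleftrightarrow> e \<in> pair_box A B"
      "p ` e \<in> pair_box B A \<longleftrightarrow> e \<in> pair_box B A"
      using e by (simp_all add: box_def pair_box_def eX card G1_def)
    then show ?thesis using e tr by (auto simp: G1_def G2_def G3_def)
  qed
  have G123: "G3 \<subseteq> G2" "G2 \<subseteq> G1" "G1 \<subseteq> triples n" by (auto simp: G1_def G2_def G3_def)
  have h2: "hom_into n EH G2"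
  proof (rule pair_box_removable[OF sub(1,2) disj(1) card(1,2) small])
    show "hom_into n EH (G2 \<union> pair_box A B)" using h1 by (rule hom_into_mono) (auto simp: G2_def)
  qed (use inv G123 in \<open>auto simp: G2_def\<close>)
  have "B \<inter> A = {}" using disj by auto
  then have "hom_into n EH G3"
  proof (rule pair_box_removable[OF sub(2,1) _ card(2,1) small])
    show "hom_into n EH (G3 \<union> pair_box B A)" using h2 by (rule hom_into_mono) (auto simp: G3_def)
  qed (use inv G123 in \<open>auto simp: G3_def\<close>)
  then obtain h where h: "\<forall>v<n. h v < n" "\<forall>e\<in>EH. h ` e \<in> G3" unfolding hom_into_def by blast
  have no_AB: "e \<inter> A = {} \<or> e \<inter> B = {}" if e: "e \<in> G3" for e
  proof (rule ccontr)
    assume *: "\<not> (e \<inter> A = {} \<or> e \<inter> B = {})"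
    have tr: "e \<subseteq> {..<n}" "card e = 3" using e G123 by (auto simp: triples_def)
    then have fin: "finite e" using card_ge_0_finite by force
    have "e \<in> triples n" "e \<notin> box n A B C" using e by (simp_all add: G1_def G2_def G3_def)
    then have "e \<inter> C = {}" using * by (simp add: box_def)
    moreover have "{..<n} = A \<union> B \<union> C" using q3 by (auto simp: A_def B_def C_def)
    ultimately have "e = (e \<inter> A) \<union> (e \<inter> B)" using tr by blast
    then have "card e = card ((e \<inter> A) \<union> (e \<inter> B))" by (rule arg_cong)
    also have "\<dots> = card (e \<inter> A) + card (e \<inter> B)"
      using fin disj by (intro card_Un_disjoint) auto
    finally have "3 = card (e \<inter> A) + card (e \<inter> B)" using tr(2) by simp
    moreover have "card (e \<inter> A) < 2" "card (e \<inter> B) < 2"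
    proof -
      have "e \<notin> pair_box A B" "e \<notin> pair_box B A" "e \<in> triples n"
        using e by (simp_all add: G1_def G2_def G3_def)
      then have "\<not> 2 \<le> card (e \<inter> A)" "\<not> 2 \<le> card (e \<inter> B)" using * unfolding pair_box_def by blast+
      then show "card (e \<inter> A) < 2" "card (e \<inter> B) < 2" by (simp_all only: not_le)
    qed
    ultimately show False by linarith
  qed
  define r where "r v = (if v \<in> A then v + q else v)" for v
  have inj: "inj_on r e" if "e \<in> G3" for e
    using no_AB[OF that] by (auto simp: inj_on_def r_def A_def B_def)
  have r: "r v \<in> {q..<n}" if "v < n" for v using that q3 by (auto simp: r_def A_def)
  have "(r \<circ> h) ` {..<n} \<subseteq> {q..<n}" using h(1) r by auto
  then have "card ((r \<circ> h) ` {..<n}) \<le> n - q" using card_mono[of "{q..<n}"] by fastforce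
  moreover have "card ((r \<circ> h) ` e) = 3" if "e \<in> EH" for e
  proof -
    have "h ` e \<in> G3" using h(2) that by blast
    then show ?thesis using card_image[OF inj[OF \<open>h ` e \<in> G3\<close>]] G123
      by (auto simp: image_comp[symmetric] triples_def simp del: o_apply)
  qed
  moreover have "\<forall>v<n. (r \<circ> h) v < n" using h(1) r by auto
  ultimately show ?thesis unfolding q_def by blast
qed

text \<open>If the pattern has a homomorphic image on few vertices, blowing up one edge of a minimal such
  image turns every triple between the three blown-up vertices into a critical one.\<close>

lemma no_small_coloring:
  assumes m: "3 * (2 ^ m - 1) \<le> s" "s \<le> n" and small: "36 * real T < sqrt (2 ^ (m + m + m))"
    and EH: "EH \<subseteq> triples n" "EH \<noteq> {}"
    and h0: "\<forall>v<n. h0 v < n" "card (h0 ` {..<n}) \<le> n - s" "\<forall>e\<in>EH. card (h0 ` e) = 3"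
  shows False
proof -
  define W where "W = h0 ` {..<n}"
  have W: "W \<subseteq> {..<n}" "finite W" using h0(1) by (auto simp: W_def)
  \<comment> \<open>Hypergraphs on the image of \<open>h0\<close> that still receive a homomorphism;
    a smallest one loses this property with the removal of any edge.\<close>
  define Pr where "Pr K \<longleftrightarrow> K \<subseteq> triples n \<and> (\<forall>e\<in>K. e \<subseteq> W) \<and> hom_into n EH K" for K
  have "Pr ((`) h0 ` EH)"
    unfolding Pr_def
  proof (intro conjI)
    show "(`) h0 ` EH \<subseteq> triples n" and "\<forall>e\<in>(`) h0 ` EH. e \<subseteq> W"
      using EH(1) h0 by (auto simp: triples_def W_def)
    show "hom_into n EH ((`) h0 ` EH)" unfolding hom_into_def using h0(1) by blast
  qed
  then obtain K where K: "Pr K" "\<And>K'. Pr K' \<Longrightarrow> card K \<le> card K'"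
    using ex_has_least_nat[of Pr _ card] by blast
  have Ktr: "K \<subseteq> triples n" "\<And>e. e \<in> K \<Longrightarrow> e \<subseteq> W" using K(1) by (simp_all add: Pr_def)
  then have finK: "finite K" by (auto intro: finite_subset)
  have "K \<noteq> {}" using K(1) EH(2) unfolding Pr_def hom_into_def by blast
  then obtain e where e: "e \<in> K" by blast
  have min: "\<not> hom_into n EH (K - {e})"
  proof
    assume "hom_into n EH (K - {e})"
    then have "Pr (K - {e})" using K(1) unfolding Pr_def by blast
    then have "card K \<le> card (K - {e})" by (rule K(2))
    then show False using e finK by (metis card_Diff1_less not_le)
  qed
  have eW: "e \<subseteq> W" "card e = 3" using e K(1) unfolding Pr_def triples_def by auto
  then obtain a b c where abc: "e = {a, b, c}" "a \<noteq> b" "a \<noteq> c" "b \<noteq> c" by (auto simp: card_3_iff)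
  \<comment> \<open>Vertices outside the image, at least \<open>3 * (2 ^ m - 1)\<close> many: enough
    to extend each of \<open>a\<close>, \<open>b\<close>, \<open>c\<close> to a class of
    \<open>2 ^ m\<close> vertices.\<close>
  define F where "F = {..<n} - W"
  have finF: "finite F" by (simp add: F_def)
  have "card F = n - card W" using W by (simp add: F_def card_Diff_subset)
  then have cF: "3 * (2 ^ m - 1) \<le> card F" using m h0(2) unfolding W_def[symmetric] by linarith
  obtain A0 where A0: "A0 \<subseteq> F" "card A0 = 2 ^ m - 1" "finite A0"
    by (rule obtain_subset_with_card_n[of "2 ^ m - 1" F]) (use cF in auto)
  have "card (F - A0) = card F - (2 ^ m - 1)" using A0 by (simp add: card_Diff_subset)
  then have "2 ^ m - 1 \<le> card (F - A0)" using cF by linarith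
  then obtain B0 where B0: "B0 \<subseteq> F - A0" "card B0 = 2 ^ m - 1" "finite B0"
    by (rule obtain_subset_with_card_n)
  have "card (F - A0 - B0) = card F - (2 ^ m - 1) - (2 ^ m - 1)"
    using A0 B0 by (simp add: card_Diff_subset)
  then have "2 ^ m - 1 \<le> card (F - A0 - B0)" using cF by linarith
  then obtain C0 where C0: "C0 \<subseteq> F - A0 - B0" "card C0 = 2 ^ m - 1" "finite C0"
    by (rule obtain_subset_with_card_n)
  define A B C where "A = insert a A0" and "B = insert b B0" and "C = insert c C0"
  have abcW: "a \<in> W" "b \<in> W" "c \<in> W" using eW abc by auto
  have notin: "a \<notin> F" "b \<notin> F" "c \<notin> F" using abcW by (auto simp: F_def)
  have one: "1 \<le> (2::nat) ^ m" by simp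
  have "a \<notin> A0" "b \<notin> B0" "c \<notin> C0" using notin A0 B0 C0 by blast+
  then have card: "card A = 2 ^ m" "card B = 2 ^ m" "card C = 2 ^ m"
    using A0 B0 C0 one by (simp_all add: A_def B_def C_def)
  have FN: "F \<subseteq> {..<n}" by (auto simp: F_def)
  have sub: "A \<subseteq> {..<n}" "B \<subseteq> {..<n}" "C \<subseteq> {..<n}"
    using A0(1) B0(1) C0(1) FN abcW W(1) unfolding A_def B_def C_def by blast+
  have disj: "A \<inter> B = {}" "A \<inter> C = {}" "B \<inter> C = {}"
    using A0(1) B0(1) C0(1) notin abc unfolding A_def B_def C_def by blast+
  have WA: "W \<inter> A = {a}" "W \<inter> B = {b}" "W \<inter> C = {c}"
    using A0(1) B0(1) C0(1) abcW unfolding A_def B_def C_def F_def by blast+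
  define r where "r v = (if v \<in> A then a else if v \<in> B then b else if v \<in> C then c else v)" for v
  have rW: "r v = v" if "v \<in> W" for v
    using that WA unfolding r_def by auto
  have rn: "r v < n" if "v < n" for v
    using that abcW W(1) by (auto simp: r_def)
  \<comment> \<open>The pullback of \<open>K - {e}\<close> along the collapse \<open>r\<close>: a
    homomorphism into \<open>G\<close> followed by \<open>r\<close> lands in \<open>K - {e}\<close>,
    which \<open>min\<close> forbids.\<close>
  define G where "G = {e' \<in> triples n. r ` e' \<in> K - {e}}"
  have Gtr: "G \<subseteq> triples n" by (auto simp: G_def)
  have rbox: "r ` e' = e" if "e' \<in> box n A B C" for e'
  proof -
    obtain x y z where xyz: "e' = {x, y, z}" "x \<in> A" "y \<in> B" "z \<in> C"
      using \<open>e' \<in> box n A B C\<close> unfolding box_eq_image[OF sub disj] by auto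
    have "r x = a" "r y = b" "r z = c" using xyz disj by (auto simp: r_def)
    then show ?thesis using xyz(1) abc(1) by simp
  qed
  then have Gbox: "G \<inter> box n A B C = {}" by (auto simp: G_def)
  have KG: "K \<subseteq> G \<union> box n A B C"
  proof
    fix e' assume e': "e' \<in> K"
    have tr: "e' \<in> triples n" "e' \<subseteq> W" using e' K(1) unfolding Pr_def by auto
    show "e' \<in> G \<union> box n A B C"
    proof (cases "e' = e")
      case True
      then show ?thesis using tr abc by (simp add: box_def A_def B_def C_def)
    next
      case False
      have "r ` e' = id ` e'" using rW tr(2) by (intro image_cong) auto
      then show ?thesis using False e' tr by (simp add: G_def)
    qed
  qed
  have inv: "p ` e' \<in> G" if V: "V \<in> {A, B, C}" and p: "p permutes V" and e': "e' \<in> G" for V p e'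
  proof -
    have pX: "p v \<in> X \<longleftrightarrow> v \<in> X" if X: "X \<in> {A, B, C}" for X v
    proof (cases "X = V")
      case True
      then show ?thesis using permutes_in_image[OF p] by simp
    next
      case False
      then have "X \<inter> V = {}" using X V disj by auto
      then show ?thesis using permutes_in_image[OF p, of v] permutes_not_in[OF p, of v] by (cases "v \<in> V") auto
    qed
    \<comment> \<open>Permuting one class leaves the values of \<open>r\<close> unchanged, hence
      \<open>G\<close> is invariant.\<close>
    have "r (p v) = r v" for v
    proof (cases "v \<in> V")
      case True
      then show ?thesis using V pX[of A v] pX[of B v] pX[of C v] by (auto simp: r_def)
    next
      case False
      then show ?thesis using permutes_not_in[OF p] by simp
    qed
    then have "r ` (p ` e') = r ` e'" by (simp add: image_image)
    moreover have "p ` e' \<in> triples n" using V sub e' by (intro permutes_triples[OF p]) (auto simp: G_def)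
    ultimately show ?thesis using e' by (simp add: G_def)
  qed
  have "hom_into n EH K" using K(1) by (simp add: Pr_def)
  then have "hom_into n EH (G \<union> box n A B C)" using KG by (rule hom_into_mono)
  then have "hom_into n EH G"
    by (rule box_removable[OF sub disj card small Gtr Gbox, rotated 3])
      (rule transitive_preservingI, rule inv, auto)+
  then have "hom_into n EH (K - {e})"
    by (rule hom_into_image[where p = r]) (use rn in \<open>auto simp: G_def\<close>)
  then show False using min by simp
qed

end

section \<open>Choice of the sizes and the final constant\<close>

lemma two_power_minus_two: "2 \<le> k \<Longrightarrow> (2::nat) ^ k = 4 * 2 ^ (k - 2)"
  by (auto simp: le_iff_add power_add)

text \<open>With \<open>m = k - 2\<close>, three sets of \<open>2 ^ m - 1\<close> new vertices fit
  into the \<open>2 ^ k\<close> vertices saved by the coloring, and \<open>3 * m\<close> is at most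
  the exponent of every box size used on the way.\<close>

lemma hom_query_lower_bound:
  assumes "3 * 2 ^ k \<le> n" "EH \<subseteq> triples n" "EH \<noteq> {}" "computes_bounded (triples n) (f_hom n EH) T"
  shows "sqrt (2 ^ (3 * (k - 2))) \<le> 36 * real T"
proof (rule ccontr)
  assume small: "\<not> sqrt (2 ^ (3 * (k - 2))) \<le> 36 * real T"
  interpret fast_hom_algorithm n EH T by unfold_locales (fact assms(4))
  define m where "m = k - 2"
  have "sqrt (2 ^ (3 * (k - 2))) \<le> sqrt (2 ^ (2 * (k - 1) + k))"
    by (intro real_sqrt_le_mono power_increasing) auto
  with small have "36 * real T < sqrt (2 ^ (2 * (k - 1) + k))" by linarith
  then obtain h where h: "\<forall>v<n. h v < n" "card (h ` {..<n}) \<le> n - 2 ^ k" "\<forall>e\<in>EH. card (h ` e) = 3"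
    using strongly_colorable_with_fewer_colors[OF assms(1) _ assms(2)] by blast
  have "3 * (2 ^ m - 1) \<le> (2::nat) ^ k"
  proof (cases "k \<ge> 2")
    case True
    then have "(2::nat) ^ k = 4 * 2 ^ m" unfolding m_def by (rule two_power_minus_two)
    then show ?thesis by simp
  qed (simp add: m_def)
  moreover have "3 * (k - 2) = m + m + m" by (simp add: m_def)
  then have "36 * real T < sqrt (2 ^ (m + m + m))" using small by (simp only: not_le)
  ultimately show False
    using no_small_coloring[of m "2 ^ k" h] assms(1,2,3) h by simp
qed

theorem theorem6:
  shows "\<exists>c::real. c > 0 \<and>
    (\<forall>n::nat. \<forall>EH :: nat set set. n \<ge> 3 \<longrightarrow> EH \<subseteq> triples n \<longrightarrow> EH \<noteq> {} \<longrightarrow>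
       real (Q (triples n) (f_hom n EH)) \<ge> c * real n powr (3/2))"
proof (intro exI[of _ "(1/24) powr (3/2) / 36"] conjI allI impI)
  fix n :: nat and EH assume n: "n \<ge> 3" and EH: "EH \<subseteq> triples n" "EH \<noteq> {}"
  let ?T = "Q (triples n) (f_hom n EH)"
  \<comment> \<open>The largest \<open>k\<close> for which three disjoint sets of size
    \<open>2 ^ k\<close> fit.\<close>
  obtain k where k: "3 * 2 ^ k \<le> n" "n < 3 * 2 ^ (k + 1)"
  proof -
    have "1 \<le> n div 3" using n by simp
    then obtain k where "2 ^ k \<le> n div 3" "n div 3 < 2 ^ (k + 1)"
      using ex_power_ivl1[of 2 "n div 3"] by auto
    then show ?thesis using that[of k] by linarith
  qed
  define x :: real where "x = 2 ^ (k - 2)"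
  \<comment> \<open>Truncated subtraction keeps this true for \<open>k < 2\<close>; with
    \<open>n < 6 * 2 ^ k\<close> it yields the factor 24 of the constant.\<close>
  have "(2::nat) ^ k \<le> 4 * 2 ^ (k - 2)"
  proof (cases "k \<ge> 2")
    case True
    then show ?thesis by (simp add: two_power_minus_two)
  next
    case False
    then have "k = 0 \<or> k = 1" by auto
    then show ?thesis by auto
  qed
  then have "n \<le> 24 * 2 ^ (k - 2)" using k(2) by simp
  then have "real n \<le> real (24 * 2 ^ (k - 2))" by (simp only: of_nat_le_iff)
  then have nx: "real n / 24 \<le> x" by (simp add: x_def)
  have x: "x > 0" by (simp add: x_def)
  have "((1/24) powr (3/2) / 36) * real n powr (3/2) = (real n / 24) powr (3/2) / 36"
    by (simp flip: powr_mult)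
  also have "\<dots> \<le> x powr (3/2) / 36" using nx by (intro divide_right_mono powr_mono2) auto
  also have "x powr (3/2) = sqrt (x ^ 3)"
    using x by (simp add: powr_half_sqrt[symmetric] powr_powr flip: powr_numeral)
  also have "x ^ 3 = 2 ^ (3 * (k - 2))" by (simp add: x_def power_mult[symmetric] mult.commute)
  also have "sqrt (2 ^ (3 * (k - 2))) / 36 \<le> real ?T"
    using hom_query_lower_bound[OF k(1) EH computes_bounded_Q[OF finite_triples]] by simp
  finally show "real ?T \<ge> (1/24) powr (3/2) / 36 * real n powr (3/2)" .
qed simp

end
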